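(* Assume $(\varphi_0,u_0,\mu_0)\in H_0^1\times H_0^1\times H$, $\eta_1\in H_0^1$, $\eta_2\in H$. Let $(\mathbf P_M^n,\mathbf Q_M^n,\mathbf U_M^n,\mathbf V_M^n)_{0\le n\le N}$ be given by the fully-discrete scheme, for $n=1,\dots,N$, $$\begin{aligned}\mathbf P_M^n=\;&\mathbf P_M^{n-1}-\Delta t\Big(\mathbf A\tfrac{\mathbf Q_M^n+\mathbf Q_M^{n-1}}2+\tfrac12\mathbf U_M^n\cdot(\mathbf Q_M^n+\mathbf Q_M^{n-1})\Big)+C_1\boldsymbol\eta_1\Delta B_1^n+\tfrac12\Delta t\,C_1\Delta B_0^n(\mathbf A\boldsymbol\eta_1+\mathbf U_M^n\cdot\boldsymbol\eta_1),\\ \mathbf Q_M^n=\;&\mathbf Q_M^{n-1}+\Delta t\Big(\mathbf A\tfrac{\mathbf P_M^n+\mathbf P_M^{n-1}}2+\tfrac12\mathbf U_M^n\cdot(\mathbf P_M^n+\mathbf P_M^{n-1})\Big)-C_1\boldsymbol\eta_1\Delta B_0^n+\tfrac12\Delta t\,C_1\Delta B_1^n(\mathbf A\boldsymbol\eta_1+\mathbf U_M^n\cdot\boldsymbol\eta_1),\\ \mathbf V_M^n=\;&\mathbf V_M^{n-1}+\tfrac12\Delta t\Big(\mathbf A\tfrac{\mathbf U_M^n+\mathbf U_M^{n-1}}2-\tfrac{\mathbf U_M^n+\mathbf U_M^{n-1}}2+\mathbf P_M^{n-1}\cdot\mathbf P_M^{n-1}+\mathbf Q_M^{n-1}\cdot\mathbf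 Q_M^{n-1}\Big)+\tfrac12C_2\boldsymbol\eta_2\Delta B_2^n\\&+\Delta t\big(C_1\mathbf P_M^{n-1}\cdot\boldsymbol\eta_1\Delta B_1^n-C_1\mathbf Q_M^{n-1}\cdot\boldsymbol\eta_1\Delta B_0^n+\Delta t\,C_1^2\boldsymbol\eta_1\cdot\boldsymbol\eta_1\big),\\ \mathbf U_M^n=\;&\mathbf U_M^{n-1}+\Delta t(\mathbf V_M^n+\mathbf V_M^{n-1})+\tfrac12\Delta t\,C_2\boldsymbol\eta_2\Delta B_2^n,\end{aligned}$$ and let $$\mathcal H(\mathbf P,\mathbf Q,\mathbf U,\mathbf V)=2\langle\mathbf U,\mathbf P\cdot\mathbf P+\mathbf Q\cdot\mathbf Q\rangle_h-\|\mathbf U\|_h^2-4\|\mathbf V\|_h^2+\langle\mathbf U,\mathbf A\mathbf U\rangle_h+2\langle\mathbf P,\mathbf A\mathbf P\rangle_h+2\langle\mathbf Q,\mathbf A\mathbf Q\rangle_h.$$ Then for every $n\in\{0,1,\dots,N\}$, $$\mathbb{E}[\mathcal H(\mathbf P_M^n,\mathbf Q_M^n,\mathbf U_M^n,\mathbf V_M^n)]=\mathbb{E}[\mathcal H(\mathbf P_M^0,\mathbf Q_M^0,\mathbf U_M^0,\mathbf V_M^0)]-C_2^2\mathcal Q_2t_n+4C_1^2\widetilde{\mathcal Q}_1t_n+4C_1^2\sum_{i=0}^{n-1}\mathbb{E}[\langle\mathbf U_M^i,\boldsymbol\eta_1\cdot\boldsymbol\eta_1\rangle_h]\,\Delta t,$$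 where $\mathcal Q_2=\|\boldsymbol\eta_2\|_h^2$ and $\widetilde{\mathcal Q}_1=\langle\boldsymbol\eta_1,\mathbf A\boldsymbol\eta_1\rangle_h$.
   Context: $H=L^2([a,b])$ and $H_0^1$ is the space of $H^1([a,b])$ functions vanishing at $a,b$. $C_1,C_2\in\mathbb{R}$; $B_0,B_1,B_2$ are independent standard real Wiener processes; $\eta_1,\eta_2$ are sufficiently smooth real-valued functions on $[a,b]$. $M$ is a positive integer, $h=(b-a)/M$, $x_i=a+ih$, and $\boldsymbol\eta_k=(\eta_k(x_1),\dots,\eta_k(x_{M-1}))^\top$ for $k=1,2$. $\mathbf A$ is the $(M-1)\times(M-1)$ tridiagonal matrix $h^{-2}\,\mathrm{tridiag}(1,-2,1)$. For $T>0$ and time step $\Delta t$, $t_n=n\Delta t$, $N=[T/\Delta t]$, and $\Delta B_k^n=B_k(t_n)-B_k(t_{n-1})$ for $k=0,1,2$. For vectors in $\mathbb{R}^{M-1}$, $\cdot$ denotes the componentwise product, $\langle f,g\rangle_h=h\sum_{i=1}^{M-1}\operatorname{Re}(f_i\bar g_i)$ and $\|f\|_h=\sqrt{\langle f,f\rangle_h}$. The initial vectors $\mathbf P_M^0,\mathbf Q_M^0,\mathbf U_M^0,\mathbf V_M^0\in\mathbb{R}^{M-1}$ are the approximations at the grid points $x_1,\dots,x_{M-1}$ of $\operatorname{Re}\varphi_0,\operatorname{Im}\varphi_0,u_0,\tfrac12\mu_0$. The scheme approximates the stochastic Klein--Gordon--Schrödinger equation with initial data $\varphi_0$ (complex-valued),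 $u_0$, $\mu_0$ (real-valued) and homogeneous Dirichlet boundary conditions. *)

theory Defs
  imports "HOL-Probability.Probability" "Jordan_Normal_Form.Matrix"
begin

hide_const (open) Finite_Cartesian_Product.vec Finite_Cartesian_Product.mat
no_notation Finite_Cartesian_Product.vec_nth (infixl "$" 90)

subsection \<open>Function spaces on an interval\<close>

text \<open>Elements of the function spaces are represented by actual functions, so that their
  values at grid points are meaningful.\<close>

definition L2 :: "real \<Rightarrow> real \<Rightarrow> (real \<Rightarrow> 'b::{banach,second_countable_topology}) set" where
  "L2 a b = {f. f \<in> borel_measurable (lebesgue_on {a..b}) \<and>
                integrable (lebesgue_on {a..b}) (\<lambda>x. (norm (f x))\<^sup>2)}"

definition test_function :: "real \<Rightarrow> real \<Rightarrow> (real \<Rightarrow> real) \<Rightarrow> bool" where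
  "test_function a b \<psi> \<longleftrightarrow>
     (\<forall>k x. (deriv ^^ k) \<psi> differentiable (at x)) \<and>
     (\<exists>c d. a < c \<and> c < d \<and> d < b \<and> (\<forall>x. x \<notin> {c..d} \<longrightarrow> \<psi> x = 0))"

definition weak_derivative ::
  "real \<Rightarrow> real \<Rightarrow> (real \<Rightarrow> 'b::{banach,second_countable_topology}) \<Rightarrow> (real \<Rightarrow> 'b) \<Rightarrow> bool" where
  "weak_derivative a b f g \<longleftrightarrow>
     (\<forall>\<psi>. test_function a b \<psi> \<longrightarrow>
        (LINT x|lebesgue_on {a..b}. deriv \<psi> x *\<^sub>R f x) =
        - (LINT x|lebesgue_on {a..b}. \<psi> x *\<^sub>R g x))"

definition H1 :: "real \<Rightarrow> real \<Rightarrow> (real \<Rightarrow> 'b::{banach,second_countable_topology}) set" where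
  "H1 a b = {f \<in> L2 a b. \<exists>g \<in> L2 a b. weak_derivative a b f g}"

text \<open>Boundary values of a Sobolev function are those of its continuous representative; hence
  the members of \<open>H10 a b\<close> are required to be that representative.\<close>

definition H10 :: "real \<Rightarrow> real \<Rightarrow> (real \<Rightarrow> 'b::{banach,second_countable_topology}) set" where
  "H10 a b = {f \<in> H1 a b. continuous_on {a..b} f \<and> f a = 0 \<and> f b = 0}"

subsection \<open>Wiener processes\<close>

text \<open>Processes have time set \<open>{0..}\<close>; their values at negative times play no role.\<close>

definition wiener_process :: "'w measure \<Rightarrow> (real \<Rightarrow> 'w \<Rightarrow> real) \<Rightarrow> bool" where
  "wiener_process \<Omega> B \<longleftrightarrow>
     (\<forall>t\<ge>0. B t \<in> borel_measurable \<Omega>) \<and>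
     (AE \<omega> in \<Omega>. B 0 \<omega> = 0) \<and>
     (\<forall>t (k::nat). 0 \<le> t 0 \<and> (\<forall>i<k. t i < t (Suc i)) \<longrightarrow>
        prob_space.indep_vars \<Omega> (\<lambda>_. borel) (\<lambda>i \<omega>. B (t (Suc i)) \<omega> - B (t i) \<omega>) {..<k}) \<and>
     (\<forall>s t. 0 \<le> s \<and> s < t \<longrightarrow>
        distributed \<Omega> lborel (\<lambda>\<omega>. B t \<omega> - B s \<omega>) (normal_density 0 (sqrt (t - s)))) \<and>
     (AE \<omega> in \<Omega>. continuous_on {0..} (\<lambda>t. B t \<omega>))"

text \<open>Independence of processes as such: each one is viewed as a single random element of
  the product space of real functions on \<open>{0..}\<close>.\<close>

definition indep_wiener_processes ::
  "'w measure \<Rightarrow> 'k set \<Rightarrow> ('k \<Rightarrow> real \<Rightarrow> 'w \<Rightarrow> real) \<Rightarrow> bool" where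
  "indep_wiener_processes \<Omega> K B \<longleftrightarrow>
     (\<forall>k\<in>K. wiener_process \<Omega> (B k)) \<and>
     prob_space.indep_vars \<Omega> (\<lambda>_. Pi\<^sub>M {0..} (\<lambda>_. borel)) (\<lambda>k \<omega>. \<lambda>t\<in>{0..}. B k t \<omega>) K"

subsection \<open>Finite differences\<close>

text \<open>Vectors are indexed from \<open>0\<close>, so that entry \<open>i\<close> belongs to the interior grid point
  \<open>a + (i + 1) h\<close>.\<close>

definition grid_vec :: "real \<Rightarrow> real \<Rightarrow> nat \<Rightarrow> (real \<Rightarrow> real) \<Rightarrow> real vec" where
  "grid_vec a h M f = Matrix.vec (M - 1) (\<lambda>i. f (a + real (i + 1) * h))"

definition laplace_mat :: "real \<Rightarrow> nat \<Rightarrow> real mat" where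
  "laplace_mat h M = (1 / h\<^sup>2) \<cdot>\<^sub>m
     Matrix.mat (M - 1) (M - 1)
       (\<lambda>(i, j). if i = j then - 2 else if i = j + 1 \<or> j = i + 1 then 1 else 0)"

definition cprod :: "real vec \<Rightarrow> real vec \<Rightarrow> real vec" (infixl "\<odot>" 75) where
  "f \<odot> g = Matrix.vec (dim_vec f) (\<lambda>i. f $ i * g $ i)"

text \<open>All vectors are real, so that real parts and conjugates disappear from the discrete
  inner product.\<close>

definition inner_h :: "real \<Rightarrow> real vec \<Rightarrow> real vec \<Rightarrow> real" where
  "inner_h h f g = h * scalar_prod f g"

definition norm_h :: "real \<Rightarrow> real vec \<Rightarrow> real" where
  "norm_h h f = sqrt (inner_h h f f)"

definition energy ::
  "real \<Rightarrow> nat \<Rightarrow> real vec \<Rightarrow> real vec \<Rightarrow> real vec \<Rightarrow> real vec \<Rightarrow> real" where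
  "energy h M P Q U V =
     2 * inner_h h U (P \<odot> P + Q \<odot> Q) - (norm_h h U)\<^sup>2 - 4 * (norm_h h V)\<^sup>2
     + inner_h h U (laplace_mat h M *\<^sub>v U)
     + 2 * inner_h h P (laplace_mat h M *\<^sub>v P)
     + 2 * inner_h h Q (laplace_mat h M *\<^sub>v Q)"

end

theory Submission
  imports Defs "Jordan_Normal_Form.Determinant"
begin

text \<open>Put \<open>\<alpha> = C1 \<Delta>B1\<close>, \<open>\<beta> = C1 \<Delta>B0\<close>, \<open>\<gamma> = C2 \<Delta>B2\<close> and move the noise into the old values:
  \<open>p0 = P + \<alpha> e1\<close>, \<open>q0 = Q - \<beta> e1\<close>, \<open>v0 = V + \<gamma>/2 e2\<close>. With \<open>L = A + diag U'\<close>, the step from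
  \<open>(p0, q0)\<close> to \<open>(P', Q')\<close> is a Crank--Nicolson step for the symmetric matrix \<open>L\<close>, so it conserves
  both \<open>|P|\<^sup>2 + |Q|\<^sup>2\<close> and the quadratic form of \<open>L\<close>. The step of \<open>(U, V)\<close> is a Crank--Nicolson step of
  the wave equation with source \<open>p0\<^sup>2 + q0\<^sup>2 - \<xi> e1\<^sup>2\<close>, where \<open>\<xi> = \<alpha>\<^sup>2 + \<beta>\<^sup>2 - 2 C1\<^sup>2 dt\<close>. Hence the new energy
  is the energy of \<open>(p0, q0, U, v0)\<close> plus \<open>2 \<xi> \<langle>e1\<^sup>2, U' - U\<rangle>\<close>. The last factor is affine in
  \<open>(\<alpha>, \<beta>, \<gamma>)\<close> with coefficients depending on the past, and \<open>\<xi>\<close> is centred and uncorrelated with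
  \<open>\<alpha>\<close>, \<open>\<beta>\<close>, \<open>\<gamma>\<close>, so this term has mean zero; expanding the rest gives the evolution law.
  All moments of the state exist because the conserved norm bounds \<open>P'\<close>, \<open>Q'\<close> and the coercivity of
  \<open>1 - dt\<^sup>2/4 (A - 1)\<close> bounds \<open>U'\<close>.\<close>

subsection \<open>Coercive linear systems\<close>

text \<open>The coercivity constant is normalised to 1, which fits matrices of the form identity
  plus a nonnegative part. Matrices are functions of two indices, of which only the entries below
  \<open>m\<close> enter.\<close>

definition coercive :: "nat \<Rightarrow> (nat \<Rightarrow> nat \<Rightarrow> real) \<Rightarrow> bool" where
  "coercive m G \<longleftrightarrow> (\<forall>y. (\<Sum>i<m. (y i)\<^sup>2) \<le> (\<Sum>i<m. y i * (\<Sum>j<m. G i j * y j)))"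

lemma mult_mat_vec_index:
  assumes "i < m"
  shows "(Matrix.mat m m (\<lambda>(i, j). G i j) *\<^sub>v Matrix.vec m y) $ i = (\<Sum>j<m. G i j * (y j :: real))"
  using assms by (simp add: scalar_prod_def atLeast0LessThan)

text \<open>A kernel vector y satisfies y . G y = 0, so coercivity forces its norm to
  vanish.\<close>

lemma coercive_det_nonzero:
  assumes "coercive m G"
  shows "Determinant.det (Matrix.mat m m (\<lambda>(i, j). G i j)) \<noteq> 0"
proof
  let ?A = "Matrix.mat m m (\<lambda>(i, j). G i j)"
  assume "Determinant.det ?A = 0"
  then obtain v where v: "v \<in> carrier_vec m" "v \<noteq> 0\<^sub>v m" "?A *\<^sub>v v = 0\<^sub>v m"
    using det_0_iff_vec_prod_zero_field[of ?A m] by auto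
  have vv: "v = Matrix.vec m (\<lambda>i. v $ i)" using v(1) by (intro eq_vecI) auto
  have "(\<Sum>j<m. G i j * v $ j) = 0" if "i < m" for i
    using mult_mat_vec_index[OF that, of G "\<lambda>i. v $ i"] v(3) that vv by simp
  then have "(\<Sum>i<m. (v $ i)\<^sup>2) \<le> 0"
    using assms[unfolded coercive_def, rule_format, of "\<lambda>i. v $ i"] by simp
  then have "(\<Sum>i<m. (v $ i)\<^sup>2) = 0"
    by (simp add: antisym sum_nonneg)
  then have "v $ i = 0" if "i < m" for i
    using that by (simp add: sum_nonneg_eq_0_iff)
  then have "v = 0\<^sub>v m" using v(1) by (intro eq_vecI) auto
  with v(2) show False by simp
qed

text \<open>Since the determinant is nonzero, the adjugate divided by it and applied to
  \<open>b\<close> is a solution. This later supplies the dual vector that removes the implicit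
  unknown from the energy balance.\<close>

lemma coercive_solution:
  assumes "coercive m G"
  obtains w where "\<And>i. i < m \<Longrightarrow> (\<Sum>j<m. G i j * w j) = b i"
proof -
  let ?A = "Matrix.mat m m (\<lambda>(i, j). G i j)"
  define d where "d = Determinant.det ?A"
  have d: "d \<noteq> 0" using coercive_det_nonzero[OF assms] by (simp add: d_def)
  define v where "v = (1 / d) \<cdot>\<^sub>v (adj_mat ?A *\<^sub>v Matrix.vec m b)"
  have A: "?A \<in> carrier_mat m m" by simp
  note adj = adj_mat[OF A]
  have v: "v \<in> carrier_vec m" using adj(1) by (simp add: v_def)
  have "?A *\<^sub>v v = (1 / d) \<cdot>\<^sub>v ((?A * adj_mat ?A) *\<^sub>v Matrix.vec m b)"
    unfolding v_def using adj(1)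
    by (subst assoc_mult_mat_vec[OF A adj(1)]) (auto simp: mult_mat_vec[OF A])
  also have "\<dots> = (1 / d) \<cdot>\<^sub>v (d \<cdot>\<^sub>v Matrix.vec m b)"
    unfolding adj(2) d_def by (intro eq_vecI) (auto simp: scalar_prod_def if_distrib[where f="(*) _"] ac_simps cong: if_cong)
  also have "\<dots> = Matrix.vec m b" using d by (intro eq_vecI) auto
  finally have *: "?A *\<^sub>v v = Matrix.vec m b" .
  have vv: "v = Matrix.vec m (\<lambda>i. v $ i)" using v by (intro eq_vecI) auto
  show ?thesis
  proof (rule that[of "\<lambda>i. v $ i"])
    fix i assume "i < m"
    then show "(\<Sum>j<m. G i j * v $ j) = b i"
      using mult_mat_vec_index[of i m G "\<lambda>i. v $ i"] * vv by simp
  qed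
qed

text \<open>Leibniz's formula makes the determinant a polynomial in the entries.\<close>

lemma borel_measurable_det:
  assumes "\<And>i j. i < m \<Longrightarrow> j < m \<Longrightarrow> (\<lambda>\<omega>. G \<omega> i j :: real) \<in> borel_measurable F"
  shows "(\<lambda>\<omega>. Determinant.det (Matrix.mat m m (\<lambda>(i, j). G \<omega> i j))) \<in> borel_measurable F"
proof -
  have "(\<lambda>\<omega>. \<Sum>p | p permutes {0..<m}. signof p * (\<Prod>i = 0..<m. G \<omega> i (p i))) \<in> borel_measurable F"
    using assms by (intro borel_measurable_sum borel_measurable_times borel_measurable_prod
        borel_measurable_const) (auto dest: permutes_in_image)
  moreover have "Determinant.det (Matrix.mat m m (\<lambda>(i, j). G \<omega> i j)) =
      (\<Sum>p | p permutes {0..<m}. signof p * (\<Prod>i = 0..<m. G \<omega> i (p i)))" for \<omega>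
    unfolding Determinant.det_def
    by (auto intro!: sum.cong prod.cong dest: permutes_in_image)
  ultimately show ?thesis by simp
qed

text \<open>Coercivity makes the solution unique at each sample point. However \<open>x\<close> was
  given, it therefore equals the quotient of determinants in Cramer's rule, and both determinants
  are measurable.\<close>

lemma measurable_linear_solution:
  assumes G: "\<And>i j. i < m \<Longrightarrow> j < m \<Longrightarrow> (\<lambda>\<omega>. G \<omega> i j :: real) \<in> borel_measurable F"
    and b: "\<And>i. i < m \<Longrightarrow> (\<lambda>\<omega>. b \<omega> i) \<in> borel_measurable F"
    and coercive: "\<And>\<omega>. \<omega> \<in> space F \<Longrightarrow> coercive m (G \<omega>)"
    and sol: "\<And>\<omega> i. \<omega> \<in> space F \<Longrightarrow> i < m \<Longrightarrow> (\<Sum>j<m. G \<omega> i j * x \<omega> j) = b \<omega> i"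
    and k: "k < m"
  shows "(\<lambda>\<omega>. x \<omega> k) \<in> borel_measurable F"
proof -
  define D where "D \<omega> = Determinant.det (Matrix.mat m m (\<lambda>(i, j). G \<omega> i j))" for \<omega>
  define E where
    "E \<omega> = Determinant.det (Matrix.mat m m (\<lambda>(i, j). if j = k then b \<omega> i else G \<omega> i j))" for \<omega>
  have "(\<lambda>\<omega>. E \<omega> / D \<omega>) \<in> borel_measurable F"
    unfolding E_def D_def using G b
    by (intro borel_measurable_divide borel_measurable_det) auto
  moreover have "E \<omega> / D \<omega> = x \<omega> k" if \<omega>: "\<omega> \<in> space F" for \<omega>
  proof -
    let ?A = "Matrix.mat m m (\<lambda>(i, j). G \<omega> i j)"
    have "D \<omega> \<noteq> 0" using coercive_det_nonzero[OF coercive[OF \<omega>]] by (simp add: D_def)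
    moreover have "replace_col ?A (?A *\<^sub>v Matrix.vec m (x \<omega>)) k =
        Matrix.mat m m (\<lambda>(i, j). if j = k then b \<omega> i else G \<omega> i j)"
      unfolding replace_col_def
      by (intro eq_matI) (auto simp: scalar_prod_def atLeast0LessThan sol[OF \<omega>])
    then have "E \<omega> = x \<omega> k * D \<omega>"
      using cramer_lemma_mat[of ?A m "Matrix.vec m (x \<omega>)" k] k by (simp add: E_def D_def)
    ultimately show ?thesis by simp
  qed
  ultimately show ?thesis by (subst measurable_cong[symmetric]) auto
qed

subsection \<open>Independence of increments\<close>

text \<open>The product over pairs is grouped by \<open>k\<close>: the conditions on process
  \<open>k\<close> form one event in path space, independence of the processes splits off these
  events, and independence within each process splits every factor further.\<close>

lemma (in prob_space) indep_vars_processes: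
  fixes W :: "'k \<Rightarrow> 'a \<Rightarrow> 'b" and f :: "'j \<Rightarrow> 'b \<Rightarrow> real"
  assumes K: "finite K" and J: "finite J"
    and W: "indep_vars (\<lambda>_. S) W K"
    and f: "\<And>j. j \<in> J \<Longrightarrow> f j \<in> borel_measurable S"
    and X: "\<And>k. k \<in> K \<Longrightarrow> indep_vars (\<lambda>_. borel) (\<lambda>j \<omega>. f j (W k \<omega>)) J"
  shows "indep_vars (\<lambda>_. borel) (\<lambda>(k, j) \<omega>. f j (W k \<omega>)) (K \<times> J)"
proof (cases "K = {} \<or> J = {}")
  \<comment> \<open>The criterion \<open>indep_vars_finite\<close> requires a nonempty index set, so
    the empty family is handled from the definition.\<close>
  case True
  then have empty: "K \<times> J = {}" by auto
  show ?thesis unfolding empty indep_vars_def indep_sets_def by simp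
next
  case False
  have Wm: "W k \<in> measurable M S" if "k \<in> K" for k
    using W that by (simp add: indep_vars_def)
  have rv: "(\<lambda>\<omega>. f j (W k \<omega>)) \<in> borel_measurable M" if "k \<in> K" "j \<in> J" for k j
    using measurable_compose[OF Wm f] that by blast
  have "prob (\<Inter>x\<in>K \<times> J. (case x of (k, j) \<Rightarrow> \<lambda>\<omega>. f j (W k \<omega>)) -` A x \<inter> space M) =
      (\<Prod>x\<in>K \<times> J. prob ((case x of (k, j) \<Rightarrow> \<lambda>\<omega>. f j (W k \<omega>)) -` A x \<inter> space M))"
    if A: "A \<in> (\<Pi> x\<in>K \<times> J. sets borel)" for A
  proof -
    \<comment> \<open>All conditions on process \<open>k\<close> are gathered into one set of paths,
      which is measurable because \<open>J\<close> is finite and nonempty.\<close>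
    define E where "E k = (\<Inter>j\<in>J. f j -` A (k, j) \<inter> space S)" for k
    have E: "E k \<in> sets S" if "k \<in> K" for k
      unfolding E_def using that A False J by (intro sets.finite_INT measurable_sets[OF f]) auto
    have EW: "W k -` E k \<inter> space M = (\<Inter>j\<in>J. (\<lambda>\<omega>. f j (W k \<omega>)) -` A (k, j) \<inter> space M)"
      if "k \<in> K" for k
      unfolding E_def using measurable_space[OF Wm[OF that]] False by auto
    have "(\<Inter>x\<in>K \<times> J. (case x of (k, j) \<Rightarrow> \<lambda>\<omega>. f j (W k \<omega>)) -` A x \<inter> space M) =
        (\<Inter>k\<in>K. \<Inter>j\<in>J. (\<lambda>\<omega>. f j (W k \<omega>)) -` A (k, j) \<inter> space M)"
      by auto
    also have "\<dots> = (\<Inter>k\<in>K. W k -` E k \<inter> space M)"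
      by (intro INF_cong refl EW[symmetric])
    also have "prob \<dots> = (\<Prod>k\<in>K. prob (W k -` E k \<inter> space M))"
      using indep_varsD[OF W, of K E] E K False by auto
    also have "\<dots> = (\<Prod>k\<in>K. \<Prod>j\<in>J. prob ((\<lambda>\<omega>. f j (W k \<omega>)) -` A (k, j) \<inter> space M))"
    proof (intro prod.cong refl)
      fix k assume k: "k \<in> K"
      show "prob (W k -` E k \<inter> space M) = (\<Prod>j\<in>J. prob ((\<lambda>\<omega>. f j (W k \<omega>)) -` A (k, j) \<inter> space M))"
        unfolding EW[OF k] using A J False k by (intro indep_varsD[OF X]) auto
    qed
    also have "\<dots> = (\<Prod>x\<in>K \<times> J. prob ((case x of (k, j) \<Rightarrow> \<lambda>\<omega>. f j (W k \<omega>)) -` A x \<inter> space M))"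
      unfolding prod.cartesian_product by (intro prod.cong refl) auto
    finally show ?thesis .
  qed
  then have indep: "\<forall>A\<in>(\<Pi> x\<in>K \<times> J. sets borel).
      prob (\<Inter>x\<in>K \<times> J. (case x of (k, j) \<Rightarrow> \<lambda>\<omega>. f j (W k \<omega>)) -` A x \<inter> space M) =
      (\<Prod>x\<in>K \<times> J. prob ((case x of (k, j) \<Rightarrow> \<lambda>\<omega>. f j (W k \<omega>)) -` A x \<inter> space M))"
    by blast
  show ?thesis
  proof (rule iffD2[OF indep_vars_finite[where E="\<lambda>_. sets borel"] indep])
    show "K \<times> J \<noteq> {}" using False by simp
    show "finite (K \<times> J)" using K J by simp
    show "random_variable borel (case x of (k, j) \<Rightarrow> \<lambda>\<omega>. f j (W k \<omega>))" if "x \<in> K \<times> J" for x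
      using that rv by (cases x) simp
    show "sets borel = sigma_sets (space borel) (sets (borel :: real measure))"
      by (rule sets.sigma_sets_eq[symmetric])
  qed (simp_all add: Int_stable_def)
qed

section \<open>Sigma-algebras generated by families of variables\<close>

definition generated :: "'w measure \<Rightarrow> ('i \<Rightarrow> 'w \<Rightarrow> real) \<Rightarrow> 'i set \<Rightarrow> 'w measure" where
  "generated M X I = vimage_algebra (space M) (\<lambda>\<omega>. \<lambda>i\<in>I. X i \<omega>) (Pi\<^sub>M I (\<lambda>_. borel))"

lemma space_generated [simp]: "space (generated M X I) = space M"
  by (simp add: generated_def)

lemma measurable_generated: "i \<in> I \<Longrightarrow> X i \<in> borel_measurable (generated M X I)"
proof -
  assume i: "i \<in> I"
  have "(\<lambda>\<omega>. \<lambda>i\<in>I. X i \<omega>) \<in> measurable (generated M X I) (Pi\<^sub>M I (\<lambda>_. borel))"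
    unfolding generated_def by (intro measurable_vimage_algebra1) (auto simp: space_PiM)
  from measurable_compose[OF this measurable_component_singleton[OF i]] i
  show ?thesis by simp
qed

lemma sets_generated_mono:
  assumes "I \<subseteq> J" shows "sets (generated M X I) \<subseteq> sets (generated M X J)"
proof -
  have "(\<lambda>\<omega>. \<lambda>i\<in>I. X i \<omega>) \<in> measurable (generated M X J) (Pi\<^sub>M I (\<lambda>_. borel))"
    using assms by (intro measurable_restrict measurable_generated) auto
  from measurable_sets[OF this] show ?thesis
    by (auto simp: generated_def[of M X I] sets_vimage_algebra2 space_PiM)
qed

lemma (in prob_space) subalgebra_generated:
  assumes "\<And>i. i \<in> I \<Longrightarrow> X i \<in> borel_measurable M"
  shows "subalgebra M (generated M X I)"
  unfolding subalgebra_def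
proof
  have "(\<lambda>\<omega>. \<lambda>i\<in>I. X i \<omega>) \<in> measurable M (Pi\<^sub>M I (\<lambda>_. borel))"
    using assms by (intro measurable_restrict) auto
  then show "sets (generated M X I) \<subseteq> sets M"
    by (auto simp: generated_def sets_vimage_algebra2 space_PiM)
qed simp

text \<open>This will separate the increments before a time step, on which the current state
  depends, from those of the step itself.\<close>

lemma (in prob_space) indep_set_generated:
  assumes "indep_vars (\<lambda>_. borel) X I" "A \<inter> B = {}" "A \<subseteq> I" "B \<subseteq> I"
  shows "indep_set (sets (generated M X A)) (sets (generated M X B))"
proof -
  have *: "sets (generated M X J) = sigma_sets (space M)
      {(\<lambda>\<omega>. \<lambda>i\<in>J. X i \<omega>) -` A \<inter> space M |A. A \<in> sets (Pi\<^sub>M J (\<lambda>_. borel))}" for J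
    by (simp add: generated_def sets_vimage_algebra)
  show ?thesis
    using indep_var_restrict[OF assms] unfolding indep_var_eq * by simp
qed

text \<open>The sigma-algebra generated by a variable measurable with respect to \<open>F\<close>
  lies inside \<open>sets F\<close>, and independence passes to smaller families.\<close>

lemma (in prob_space) indep_var_of_indep_set:
  assumes "indep_set (sets F) (sets G)" "space F = space M" "space G = space M"
    and "X \<in> borel_measurable F" "Y \<in> borel_measurable G"
  shows "indep_var borel X borel Y"
proof -
  have ev: "sets F \<subseteq> events" "sets G \<subseteq> events"
    using indep_setD_ev1[OF assms(1)] indep_setD_ev2[OF assms(1)] .
  have sub: "subalgebra M F" "subalgebra M G"
    using ev assms by (auto simp: subalgebra_def)
  have "sigma_sets (space M) {X -` A \<inter> space M |A. A \<in> sets borel} \<subseteq> sets F"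
    unfolding assms(2)[symmetric] using measurable_sets[OF assms(4)]
    by (intro sets.sigma_sets_subset) auto
  moreover have "sigma_sets (space M) {Y -` A \<inter> space M |A. A \<in> sets borel} \<subseteq> sets G"
    unfolding assms(3)[symmetric] using measurable_sets[OF assms(5)]
    by (intro sets.sigma_sets_subset) auto
  ultimately have "indep_set (sigma_sets (space M) {X -` A \<inter> space M |A. A \<in> sets borel})
     (sigma_sets (space M) {Y -` A \<inter> space M |A. A \<in> sets borel})"
    using assms(1) ev unfolding indep_sets2_eq by blast
  then show ?thesis
    unfolding indep_var_eq
    using measurable_from_subalg[OF sub(1) assms(4)] measurable_from_subalg[OF sub(2) assms(5)] by simp
qed

subsection \<open>One step of the scheme\<close>

text \<open>Matrices act on index functions here, so that the algebra of a step is free of the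
  carrier and dimension conditions of \<open>vec\<close> and \<open>mat\<close>.\<close>

definition lin :: "nat \<Rightarrow> (nat \<Rightarrow> nat \<Rightarrow> real) \<Rightarrow> (nat \<Rightarrow> real) \<Rightarrow> nat \<Rightarrow> real" where
  "lin m A x i = (\<Sum>j<m. A i j * x j)"

lemma lin_add: "lin m A (\<lambda>j. x j + y j) i = lin m A x i + lin m A y i"
  and lin_diff: "lin m A (\<lambda>j. x j - y j) i = lin m A x i - lin m A y i"
  and lin_scale: "lin m A (\<lambda>j. c * x j) i = c * lin m A x i"
  and lin_divide: "lin m A (\<lambda>j. x j / c) i = lin m A x i / c"
  by (simp_all add: lin_def algebra_simps sum.distrib sum_subtractf sum_distrib_left sum_divide_distrib)

lemmas lin_simps = lin_add lin_diff lin_scale lin_divide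

lemma lin_symmetric:
  assumes "\<And>i j. A i j = A j i"
  shows "(\<Sum>i<m. x i * lin m A y i) = (\<Sum>i<m. y i * lin m A x i)"
proof -
  have "(\<Sum>i<m. x i * lin m A y i) = (\<Sum>i<m. \<Sum>j<m. x i * (A i j * y j))"
    by (simp add: lin_def sum_distrib_left)
  also have "\<dots> = (\<Sum>j<m. \<Sum>i<m. y j * (A j i * x i))"
    by (subst sum.swap) (intro sum.cong refl, simp add: assms[of _ _] ac_simps)
  finally show ?thesis by (simp add: lin_def sum_distrib_left)
qed

lemma lin_cong: "(\<And>j. j < m \<Longrightarrow> x j = y j) \<Longrightarrow> lin m A x i = lin m A y i"
  by (simp add: lin_def)

text \<open>The matrices \<open>U_mat\<close>, \<open>L_mat\<close> and \<open>P_mat\<close> below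
  all have this shape, a diagonal plus a multiple of a given matrix. Factors such as
  \<open>1 *\<close> and \<open>+ -\<close> in their definitions make the rule match.\<close>

lemma lin_diagonal_plus:
  "i < m \<Longrightarrow> lin m (\<lambda>i j. (if i = j then a i else 0) + c * A i j) x i = a i * x i + c * lin m A x i"
  by (simp add: lin_def distrib_right sum.distrib sum_distrib_left mult.assoc
      if_distrib[where f="\<lambda>z. z * _"] cong: if_cong)

lemma lin_comp: "lin m (\<lambda>i j. \<Sum>k<m. A i k * B k j) x i = lin m A (lin m B x) i"
proof -
  have "lin m (\<lambda>i j. \<Sum>k<m. A i k * B k j) x i = (\<Sum>j<m. \<Sum>k<m. A i k * (B k j * x j))"
    by (simp add: lin_def sum_distrib_right mult.assoc)
  also have "\<dots> = (\<Sum>k<m. \<Sum>j<m. A i k * (B k j * x j))"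
    by (rule sum.swap)
  finally show ?thesis by (simp add: lin_def sum_distrib_left)
qed

lemma coercive_iff: "coercive m G \<longleftrightarrow> (\<forall>y. (\<Sum>i<m. (y i)\<^sup>2) \<le> (\<Sum>i<m. y i * lin m G y i))"
  by (simp add: coercive_def lin_def)

text \<open>Testing with y and Young's inequality give |y|^2 <= y . r <= (|y|^2 + |r|^2) / 2, and
  the first term on the right is absorbed.\<close>

lemma coercive_bound:
  assumes "coercive m G" "\<And>i. i < m \<Longrightarrow> lin m G y i = r i"
  shows "(\<Sum>i<m. (y i)\<^sup>2) \<le> (\<Sum>i<m. (r i)\<^sup>2)"
proof -
  have "2 * (y i * r i) \<le> (y i)\<^sup>2 + (r i)\<^sup>2" for i
    using sum_squares_bound[of "y i" "r i"] by simp
  then have "2 * (\<Sum>i<m. y i * r i) \<le> (\<Sum>i<m. (y i)\<^sup>2 + (r i)\<^sup>2)"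
    unfolding sum_distrib_left by (intro sum_mono)
  moreover have "(\<Sum>i<m. (y i)\<^sup>2) \<le> (\<Sum>i<m. y i * r i)"
    using assms(1)[unfolded coercive_iff, rule_format, of y] assms(2) by simp
  ultimately show ?thesis by (simp add: sum.distrib)
qed

text \<open>A polynomial majorant in place of a square root keeps the bounds inside the algebra of
  variables with all moments.\<close>

lemma abs_le_one_plus_sum_squares:
  fixes y :: "nat \<Rightarrow> real"
  assumes "i < m"
  shows "\<bar>y i\<bar> \<le> 1 + (\<Sum>i<m. (y i)\<^sup>2)"
proof -
  have "\<bar>y i\<bar> \<le> 1 + (y i)\<^sup>2"
    using sum_squares_bound[of 1 "\<bar>y i\<bar>"] by (simp add: power2_eq_square)
  also have "(y i)\<^sup>2 \<le> (\<Sum>i<m. (y i)\<^sup>2)"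
    using assms by (intro member_le_sum) auto
  finally show ?thesis by simp
qed

text \<open>This is the discrete energy without the mesh weight \<open>h\<close>; the factor is
  restored by \<open>energy_eq_grid_energy\<close>.\<close>

definition grid_energy ::
  "nat \<Rightarrow> (nat \<Rightarrow> nat \<Rightarrow> real) \<Rightarrow> (nat \<Rightarrow> real) \<Rightarrow> (nat \<Rightarrow> real) \<Rightarrow> (nat \<Rightarrow> real) \<Rightarrow> (nat \<Rightarrow> real) \<Rightarrow> real"
  where
  "grid_energy m A p q u v =
     (\<Sum>i<m. 2 * (u i * ((p i)\<^sup>2 + (q i)\<^sup>2)) - (u i)\<^sup>2 - 4 * (v i)\<^sup>2 + u i * lin m A u i
        + 2 * (p i * lin m A p i) + 2 * (q i * lin m A q i))"

text \<open>Here \<open>\<alpha> = C1 * dB 1 n\<close>, \<open>\<beta> = C1 * dB 0 n\<close>, \<open>\<gamma> = C2 * dB 2 n\<close>; primed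
  letters are the new values.\<close>

locale scheme_step =
  fixes m :: nat and A :: "nat \<Rightarrow> nat \<Rightarrow> real" and dt C1 \<alpha> \<beta> \<gamma> :: real
    and e e2 p q u v p' q' u' v' :: "nat \<Rightarrow> real"
  assumes sym: "\<And>i j. A i j = A j i"
    and nonpos: "\<And>x. (\<Sum>i<m. x i * lin m A x i) \<le> 0"
    and P: "\<And>i. i < m \<Longrightarrow> p' i = p i
        - dt * (lin m A (\<lambda>j. (q' j + q j) / 2) i + u' i * (q' i + q i) / 2)
        + \<alpha> * e i + dt / 2 * \<beta> * (lin m A e i + u' i * e i)"
    and Q: "\<And>i. i < m \<Longrightarrow> q' i = q i
        + dt * (lin m A (\<lambda>j. (p' j + p j) / 2) i + u' i * (p' i + p i) / 2)
        - \<beta> * e i + dt / 2 * \<alpha> * (lin m A e i + u' i * e i)"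
    and V: "\<And>i. i < m \<Longrightarrow> v' i = v i
        + dt / 2 * (lin m A (\<lambda>j. (u' j + u j) / 2) i - (u' i + u i) / 2 + (p i)\<^sup>2 + (q i)\<^sup>2)
        + \<gamma> / 2 * e2 i
        + dt * (\<alpha> * (p i * e i) - \<beta> * (q i * e i) + dt * C1\<^sup>2 * (e i)\<^sup>2)"
    and U: "\<And>i. i < m \<Longrightarrow> u' i = u i + dt * (v' i + v i) + dt / 2 * \<gamma> * e2 i"
begin

text \<open>With the noise absorbed into the old values, the noise enters the step only through \<open>\<xi>\<close>;
  see \<open>P0\<close>, \<open>Q0\<close>, \<open>V0\<close>, \<open>U0\<close> and \<open>F_eq\<close>.\<close>

definition p0 where "p0 i = p i + \<alpha> * e i"
definition q0 where "q0 i = q i - \<beta> * e i"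
definition v0 where "v0 i = v i + \<gamma> / 2 * e2 i"
definition \<xi> where "\<xi> = \<alpha>\<^sup>2 + \<beta>\<^sup>2 - 2 * C1\<^sup>2 * dt"
definition L where "L x i = lin m A x i + u' i * x i"

lemma lin_p0: "lin m A p0 i = lin m A p i + \<alpha> * lin m A e i"
  and lin_q0: "lin m A q0 i = lin m A q i - \<beta> * lin m A e i"
  unfolding p0_def[abs_def] q0_def[abs_def] lin_simps by simp_all

text \<open>The terms of the scheme with factor dt / 2 * \<beta> are exactly what turns the midpoint
  formed with \<open>q\<close> into the one formed with \<open>q0\<close>. The \<alpha> terms play
  the same part in \<open>Q0\<close>.\<close>

lemma P0: "i < m \<Longrightarrow> p' i - p0 i = - (dt / 2 * L (\<lambda>j. q' j + q0 j) i)"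
  using P[of i] by (simp add: L_def p0_def q0_def lin_simps field_simps)

lemma Q0: "i < m \<Longrightarrow> q' i - q0 i = dt / 2 * L (\<lambda>j. p' j + p0 j) i"
  using Q[of i] by (simp add: L_def p0_def q0_def lin_simps field_simps)

section \<open>Conservation laws of the Crank-Nicolson steps\<close>

lemma L_symmetric: "(\<Sum>i<m. x i * L y i) = (\<Sum>i<m. y i * L x i)"
  using lin_symmetric[OF sym, where x=x and y=y] by (simp add: L_def algebra_simps sum.distrib)

lemma L_simps:
  "L (\<lambda>j. x j + y j) i = L x i + L y i" "L (\<lambda>j. x j - y j) i = L x i - L y i"
  "L (\<lambda>j. c * x j) i = c * L x i" "L (\<lambda>j. x j / c) i = L x i / c"
  by (simp_all add: L_def lin_simps algebra_simps add_divide_distrib)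

text \<open>By symmetry the mixed terms x . S y and y . S x cancel. The operator is abstract because
  the identity serves both \<open>L\<close> and, for the wave equation, the operator A - 1.\<close>

lemma form_difference:
  fixes S :: "(nat \<Rightarrow> real) \<Rightarrow> nat \<Rightarrow> real"
  assumes "\<And>x y. (\<Sum>i<m. x i * S y i) = (\<Sum>i<m. y i * S x i)"
    and "\<And>x y i. S (\<lambda>j. x j + y j) i = S x i + S y i"
  shows "(\<Sum>i<m. x i * S x i) - (\<Sum>i<m. y i * S y i) = (\<Sum>i<m. (x i - y i) * S (\<lambda>j. x j + y j) i)"
  unfolding assms(2) distrib_left left_diff_distrib sum.distrib sum_subtractf
  using assms(1)[of x y] by simp

text \<open>Tested with p' + p0 and q' + q0, the two equations contribute the same bilinear form of
  \<open>L\<close> with opposite signs.\<close>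

lemma norm_conserved:
  "(\<Sum>i<m. (p' i)\<^sup>2 + (q' i)\<^sup>2) = (\<Sum>i<m. (p0 i)\<^sup>2 + (q0 i)\<^sup>2)"
proof -
  let ?r = "\<lambda>i. p' i + p0 i" and ?t = "\<lambda>i. q' i + q0 i"
  have "(\<Sum>i<m. (p' i)\<^sup>2 + (q' i)\<^sup>2) - (\<Sum>i<m. (p0 i)\<^sup>2 + (q0 i)\<^sup>2) =
      (\<Sum>i<m. (p' i - p0 i) * ?r i + (q' i - q0 i) * ?t i)"
    by (simp add: power2_eq_square algebra_simps sum.distrib sum_subtractf)
  also have "\<dots> = (\<Sum>i<m. dt / 2 * (?t i * L ?r i) - dt / 2 * (?r i * L ?t i))"
    by (intro sum.cong refl) (simp add: P0 Q0 field_simps)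
  also have "\<dots> = 0"
    unfolding sum_subtractf sum_distrib_left[symmetric] using L_symmetric[of ?t ?r] by simp
  finally show ?thesis by simp
qed

text \<open>By \<open>form_difference\<close> each form changes by the increment times
  \<open>L\<close> of the sum. Each increment is itself a multiple of \<open>L\<close> of the other
  component's sum, with opposite signs, so the two contributions cancel at every index.\<close>

lemma form_conserved:
  "(\<Sum>i<m. p' i * L p' i) + (\<Sum>i<m. q' i * L q' i) =
   (\<Sum>i<m. p0 i * L p0 i) + (\<Sum>i<m. q0 i * L q0 i)"
proof -
  have "(\<Sum>i<m. p' i * L p' i) - (\<Sum>i<m. p0 i * L p0 i) +
      ((\<Sum>i<m. q' i * L q' i) - (\<Sum>i<m. q0 i * L q0 i)) =
      (\<Sum>i<m. (p' i - p0 i) * L (\<lambda>j. p' j + p0 j) i) + (\<Sum>i<m. (q' i - q0 i) * L (\<lambda>j. q' j + q0 j) i)"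
    by (simp only: form_difference[OF L_symmetric L_simps(1)])
  also have "\<dots> = 0"
    unfolding sum.distrib[symmetric] by (intro sum.neutral) (simp add: P0 Q0)
  finally show ?thesis by simp
qed

text \<open>The source of the wave equation as the scheme supplies it: it is p0^2 + q0^2 with the
  coefficient \<alpha>^2 + \<beta>^2 of e^2 replaced by 2 * C1^2 * dt, its mean for Wiener
  increments.\<close>

definition F where
  "F i = (p i)\<^sup>2 + (q i)\<^sup>2 + 2 * \<alpha> * (p i * e i) - 2 * \<beta> * (q i * e i) + 2 * C1\<^sup>2 * dt * (e i)\<^sup>2"

lemma F_eq: "F i = (p0 i)\<^sup>2 + (q0 i)\<^sup>2 - \<xi> * (e i)\<^sup>2"
  by (simp add: F_def p0_def q0_def \<xi>_def power2_eq_square algebra_simps)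

lemma V0: "i < m \<Longrightarrow> v' i - v0 i =
    dt / 2 * (lin m A (\<lambda>j. u' j + u j) i / 2 - (u' i + u i) / 2 + F i)"
  and U0: "i < m \<Longrightarrow> u' i - u i = dt * (v' i + v0 i)"
  using V[of i] U[of i]
  by (simp_all add: F_def v0_def lin_simps field_simps power2_eq_square)

text \<open>Inserting \<open>V0\<close> into \<open>U0\<close> removes \<open>v'\<close>. With the
  increment u' - u as the unknown, only old values and noise remain on the right.\<close>

lemma U_implicit: "i < m \<Longrightarrow>
  (u' i - u i) - dt\<^sup>2 / 4 * (lin m A (\<lambda>j. u' j - u j) i - (u' i - u i)) =
  2 * dt * v0 i + dt\<^sup>2 / 2 * (lin m A u i - u i + F i)"
proof -
  assume i: "i < m"
  have "u' i - u i = dt * (2 * v0 i + (v' i - v0 i))" using U0[OF i] by simp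
  then show ?thesis
    unfolding V0[OF i] by (simp add: lin_simps field_simps power2_eq_square)
qed

text \<open>The two subsystems conserve their parts up to the coupling: the first weighs the density
  with \<open>u'\<close>, and the wave part is driven by \<open>F\<close> instead of p0^2 + q0^2.
  This mismatch is the \<xi> term.\<close>

lemma energy_step:
  "grid_energy m A p' q' u' v' =
    (\<Sum>i<m. 2 * (u i * ((p0 i)\<^sup>2 + (q0 i)\<^sup>2)) - (u i)\<^sup>2 - 4 * (v0 i)\<^sup>2 + u i * lin m A u i
        + 2 * (p0 i * lin m A p0 i) + 2 * (q0 i * lin m A q0 i)) +
    2 * \<xi> * (\<Sum>i<m. (e i)\<^sup>2 * (u' i - u i))"
proof -
  \<comment> \<open>\<open>K\<close> collects the quadratic terms of \<open>u\<close> in the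
    energy.\<close>
  define K where "K x i = lin m A x i - x i" for x :: "nat \<Rightarrow> real" and i
  have K: "(\<Sum>i<m. x i * K y i) = (\<Sum>i<m. y i * K x i)" "K (\<lambda>j. x j + y j) i = K x i + K y i" for x y i
    using lin_symmetric[OF sym, where x=x and y=y]
    by (simp_all add: K_def lin_simps algebra_simps sum_subtractf)
  have "4 * (v' i)\<^sup>2 = 4 * (v0 i)\<^sup>2 + (u' i - u i) * K (\<lambda>j. u' j + u j) i + 2 * (F i * (u' i - u i))"
    if i: "i < m" for i
  proof -
    \<comment> \<open>In the difference of squares, \<open>V0\<close> evaluates v' - v0, and
      \<open>U0\<close> turns dt * (v' + v0) into u' - u.\<close>
    have "4 * (v' i)\<^sup>2 - 4 * (v0 i)\<^sup>2 = 4 * (v' i - v0 i) * (v' i + v0 i)"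
      by (simp add: power2_eq_square algebra_simps)
    also have "\<dots> = 2 * (K (\<lambda>j. u' j + u j) i / 2 + F i) * (dt * (v' i + v0 i))"
      unfolding V0[OF i] by (simp add: K_def field_simps)
    finally show ?thesis unfolding U0[OF i, symmetric] by (simp add: field_simps)
  qed
  then have "(\<Sum>i<m. 4 * (v' i)\<^sup>2) =
      (\<Sum>i<m. 4 * (v0 i)\<^sup>2 + (u' i - u i) * K (\<lambda>j. u' j + u j) i + 2 * (F i * (u' i - u i)))"
    by (intro sum.cong) auto
  then have "4 * (\<Sum>i<m. (v' i)\<^sup>2) = 4 * (\<Sum>i<m. (v0 i)\<^sup>2) +
      (\<Sum>i<m. (u' i - u i) * K (\<lambda>j. u' j + u j) i) + 2 * (\<Sum>i<m. F i * (u' i - u i))"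
    unfolding sum.distrib sum_distrib_left[symmetric] .
  also have "(\<Sum>i<m. (u' i - u i) * K (\<lambda>j. u' j + u j) i) =
      (\<Sum>i<m. u' i * K u' i) - (\<Sum>i<m. u i * K u i)"
    using form_difference[OF K] by simp
  finally have V': "4 * (\<Sum>i<m. (v' i)\<^sup>2) = 4 * (\<Sum>i<m. (v0 i)\<^sup>2) +
      (\<Sum>i<m. u' i * K u' i) - (\<Sum>i<m. u i * K u i) + 2 * (\<Sum>i<m. F i * (u' i - u i))"
    by simp
  \<comment> \<open>The cubic coupling at the new time is absorbed into \<open>L\<close>, whose
    diagonal part is \<open>u'\<close>.\<close>
  have "grid_energy m A p' q' u' v' =
      2 * ((\<Sum>i<m. p' i * L p' i) + (\<Sum>i<m. q' i * L q' i)) + (\<Sum>i<m. u' i * K u' i) - 4 * (\<Sum>i<m. (v' i)\<^sup>2)"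
    unfolding grid_energy_def L_def K_def distrib_left sum_distrib_left
      sum.distrib[symmetric] sum_subtractf[symmetric]
    by (intro sum.cong refl) (simp add: power2_eq_square algebra_simps)
  also have "\<dots> = 2 * ((\<Sum>i<m. p0 i * L p0 i) + (\<Sum>i<m. q0 i * L q0 i)) +
      (\<Sum>i<m. u i * K u i) - 4 * (\<Sum>i<m. (v0 i)\<^sup>2) - 2 * (\<Sum>i<m. F i * (u' i - u i))"
    unfolding form_conserved V' by simp
  \<comment> \<open>\<open>L\<close> still puts the weight \<open>u'\<close> on p0^2 + q0^2.
    Subtracting 2 * F * (u' - u) changes this weight to \<open>u\<close> and leaves the \<xi>
    term.\<close>
  also have "\<dots> = (\<Sum>i<m. 2 * (u i * ((p0 i)\<^sup>2 + (q0 i)\<^sup>2)) - (u i)\<^sup>2 - 4 * (v0 i)\<^sup>2 + u i * lin m A u i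
        + 2 * (p0 i * lin m A p0 i) + 2 * (q0 i * lin m A q0 i)) +
    2 * \<xi> * (\<Sum>i<m. (e i)\<^sup>2 * (u' i - u i))"
    unfolding L_def K_def F_eq distrib_left sum_distrib_left
      sum.distrib[symmetric] sum_subtractf[symmetric]
    by (intro sum.cong refl) (simp add: power2_eq_square algebra_simps)
  finally show ?thesis .
qed

section \<open>Coercive systems for the new values\<close>

definition U_mat where
  "U_mat i j = (if i = j then 1 + dt\<^sup>2 / 4 else 0) + - (dt\<^sup>2 / 4) * A i j"

lemma lin_U_mat: "i < m \<Longrightarrow> lin m U_mat y i = y i - dt\<^sup>2 / 4 * (lin m A y i - y i)"
  unfolding U_mat_def lin_diagonal_plus by (simp add: field_simps)

text \<open>The matrix is 1 + dt^2 / 4 - (dt^2 / 4) A, and -A is positive semidefinite by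
  \<open>nonpos\<close>.\<close>

lemma coercive_U_mat: "coercive m U_mat"
  unfolding coercive_iff
proof
  fix y
  have "(\<Sum>i<m. y i * lin m U_mat y i) =
      (\<Sum>i<m. (y i)\<^sup>2) + dt\<^sup>2 / 4 * (\<Sum>i<m. (y i)\<^sup>2) - dt\<^sup>2 / 4 * (\<Sum>i<m. y i * lin m A y i)"
    unfolding sum_distrib_left sum.distrib[symmetric] sum_subtractf[symmetric]
    by (intro sum.cong refl) (simp add: lin_U_mat power2_eq_square field_simps)
  moreover have "dt\<^sup>2 / 4 * (\<Sum>i<m. y i * lin m A y i) \<le> 0"
    using nonpos[of y] by (simp add: mult_nonneg_nonpos)
  moreover have "0 \<le> dt\<^sup>2 / 4 * (\<Sum>i<m. (y i)\<^sup>2)"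
    by (simp add: sum_nonneg)
  ultimately show "(\<Sum>i<m. (y i)\<^sup>2) \<le> (\<Sum>i<m. y i * lin m U_mat y i)"
    by simp
qed

definition L_mat where "L_mat i j = (if i = j then u' i else 0) + 1 * A i j"

lemma lin_L_mat: "i < m \<Longrightarrow> lin m L_mat y i = L y i"
  unfolding L_mat_def lin_diagonal_plus by (simp add: L_def)

lemma L_cong: "(\<And>j. j < m \<Longrightarrow> x j = y j) \<Longrightarrow> i < m \<Longrightarrow> L x i = L y i"
  by (simp add: L_def cong: lin_cong)

text \<open>Eliminating \<open>q'\<close> leaves a coercive system for \<open>p'\<close> with matrix \<open>1 + (dt/2)\<^sup>2 L\<^sup>2\<close>.\<close>

definition P_mat where
  "P_mat i j = (if i = j then 1 else 0) + (dt / 2)\<^sup>2 * (\<Sum>k<m. L_mat i k * L_mat k j)"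

lemma lin_P_mat: "i < m \<Longrightarrow> lin m P_mat y i = y i + (dt / 2)\<^sup>2 * L (L y) i"
  unfolding P_mat_def lin_diagonal_plus lin_comp
  by (simp add: lin_L_mat L_cong[of "lin m L_mat y" "L y"])

text \<open>Symmetry of \<open>L\<close> turns y . L (L y) into |L y|^2.\<close>

lemma coercive_P_mat: "coercive m P_mat"
  unfolding coercive_iff
proof
  fix y
  have "(\<Sum>i<m. y i * lin m P_mat y i) = (\<Sum>i<m. (y i)\<^sup>2) + (dt / 2)\<^sup>2 * (\<Sum>i<m. y i * L (L y) i)"
    unfolding sum_distrib_left sum.distrib[symmetric]
    by (intro sum.cong refl) (simp add: lin_P_mat power2_eq_square algebra_simps)
  also have "(\<Sum>i<m. y i * L (L y) i) = (\<Sum>i<m. (L y i)\<^sup>2)"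
    using L_symmetric[of y "L y"] by (simp add: power2_eq_square)
  finally show "(\<Sum>i<m. (y i)\<^sup>2) \<le> (\<Sum>i<m. y i * lin m P_mat y i)"
    by (simp add: sum_nonneg)
qed

lemma P_implicit:
  assumes "i < m"
  shows "lin m P_mat p' i = p0 i - dt * L q0 i - (dt / 2)\<^sup>2 * L (L p0) i"
proof -
  \<comment> \<open>Writing the sum as the increment plus 2 * q0 lets \<open>Q0\<close> eliminate
    the unknown \<open>q'\<close>.\<close>
  have "L (\<lambda>j. q' j + q0 j) i = L (\<lambda>j. (q' j - q0 j) + 2 * q0 j) i"
    using assms by (intro L_cong) auto
  also have "\<dots> = L (\<lambda>j. dt / 2 * L (\<lambda>j. p' j + p0 j) j + 2 * q0 j) i"
    by (intro L_cong assms arg_cong2[where f="(+)"] refl Q0)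
  also have "\<dots> = dt / 2 * (L (L p') i + L (L p0) i) + 2 * L q0 i"
    by (simp add: L_simps field_simps)
  finally have L_q: "L (\<lambda>j. q' j + q0 j) i = dt / 2 * (L (L p') i + L (L p0) i) + 2 * L q0 i" .
  show ?thesis
    using P0[OF assms] unfolding L_q lin_P_mat[OF assms] by (simp add: power2_eq_square field_simps)
qed

text \<open>Conservation of the norm bounds \<open>p'\<close> by old values and noise alone,
  although its equation contains \<open>u'\<close>.\<close>

lemma P_bound: "i < m \<Longrightarrow> \<bar>p' i\<bar> \<le> 1 + (\<Sum>i<m. (p0 i)\<^sup>2 + (q0 i)\<^sup>2)"
  unfolding norm_conserved[symmetric]
  using abs_le_one_plus_sum_squares[of i m p'] sum_nonneg[of "{..<m}" "\<lambda>i. (q' i)\<^sup>2"]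
  by (simp add: sum.distrib)

definition r where "r i = 2 * dt * v0 i + dt\<^sup>2 / 2 * (lin m A u i - u i + F i)"

lemma U_equation: "i < m \<Longrightarrow> lin m U_mat (\<lambda>j. u' j - u j) i = r i"
  unfolding lin_U_mat r_def by (rule U_implicit)

lemma U_bound: "i < m \<Longrightarrow> \<bar>u' i - u i\<bar> \<le> 1 + (\<Sum>i<m. (r i)\<^sup>2)"
  using abs_le_one_plus_sum_squares[of i m "\<lambda>i. u' i - u i"]
    coercive_bound[OF coercive_U_mat, where y="\<lambda>i. u' i - u i", OF U_equation]
  by fastforce

text \<open>Every noise monomial gets a coefficient that depends on the old values only. To this end
  the implicit increment u' - u in \<open>energy_step\<close> is removed by duality: since
  \<open>U_mat\<close> is symmetric, pairing e^2 with u' - u equals pairing \<open>w\<close> with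
  the explicit right-hand side \<open>r\<close>, which is affine in the noise.\<close>

lemma energy_increment:
  assumes w: "\<And>i. i < m \<Longrightarrow> lin m U_mat w i = (e i)\<^sup>2"
  shows "grid_energy m A p' q' u' v' = grid_energy m A p q u v
    + \<alpha> * (\<Sum>i<m. 4 * (p i * (lin m A e i + u i * e i)))
    + \<beta> * (\<Sum>i<m. - 4 * (q i * (lin m A e i + u i * e i)))
    + (\<alpha>\<^sup>2 + \<beta>\<^sup>2) * (\<Sum>i<m. 2 * (e i * (lin m A e i + u i * e i)))
    + \<gamma> * (\<Sum>i<m. - 4 * (v i * e2 i)) + \<gamma>\<^sup>2 * (\<Sum>i<m. - (e2 i)\<^sup>2)
    + \<xi> * (\<Sum>i<m. 2 * w i * (2 * dt * v i + dt\<^sup>2 / 2 *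
          (lin m A u i - u i + (p i)\<^sup>2 + (q i)\<^sup>2 + 2 * C1\<^sup>2 * dt * (e i)\<^sup>2)))
    + \<alpha> * \<xi> * (\<Sum>i<m. 2 * w i * (dt\<^sup>2 * (p i * e i)))
    + \<beta> * \<xi> * (\<Sum>i<m. - 2 * w i * (dt\<^sup>2 * (q i * e i)))
    + \<gamma> * \<xi> * (\<Sum>i<m. 2 * w i * (dt * e2 i))"
proof -
  have U_sym: "(\<Sum>i<m. x i * lin m U_mat y i) = (\<Sum>i<m. y i * lin m U_mat x i)" for x y
    by (rule lin_symmetric) (auto simp: U_mat_def sym)
  have "(\<Sum>i<m. (e i)\<^sup>2 * (u' i - u i)) = (\<Sum>i<m. w i * r i)"
    using U_sym[of "\<lambda>i. u' i - u i" w] by (simp add: U_equation w mult.commute)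
  then have w_r: "2 * \<xi> * (\<Sum>i<m. (e i)\<^sup>2 * (u' i - u i)) = (\<Sum>i<m. 2 * \<xi> * (w i * r i))"
    by (simp add: sum_distrib_left)
  have 1: "2 * \<xi> * (\<Sum>i<m. (e i)\<^sup>2 * (u' i - u i)) =
      \<xi> * (\<Sum>i<m. 2 * w i * (2 * dt * v i + dt\<^sup>2 / 2 *
          (lin m A u i - u i + (p i)\<^sup>2 + (q i)\<^sup>2 + 2 * C1\<^sup>2 * dt * (e i)\<^sup>2)))
    + \<alpha> * \<xi> * (\<Sum>i<m. 2 * w i * (dt\<^sup>2 * (p i * e i)))
    + \<beta> * \<xi> * (\<Sum>i<m. - 2 * w i * (dt\<^sup>2 * (q i * e i)))
    + \<gamma> * \<xi> * (\<Sum>i<m. 2 * w i * (dt * e2 i))"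
    unfolding w_r
    unfolding sum_distrib_left sum.distrib[symmetric]
    by (intro sum.cong refl) (simp add: r_def F_def v0_def field_simps power2_eq_square)
  have el: "(\<Sum>i<m. e i * lin m A p i) = (\<Sum>i<m. p i * lin m A e i)"
    "(\<Sum>i<m. e i * lin m A q i) = (\<Sum>i<m. q i * lin m A e i)"
    by (rule lin_symmetric[OF sym])+
  \<comment> \<open>The last two lines vanish by symmetry of \<open>A\<close>. They are carried
    along because with them the expansion is an identity at every single index.\<close>
  have 2: "(\<Sum>i<m. 2 * (u i * ((p0 i)\<^sup>2 + (q0 i)\<^sup>2)) - (u i)\<^sup>2 - 4 * (v0 i)\<^sup>2 + u i * lin m A u i
        + 2 * (p0 i * lin m A p0 i) + 2 * (q0 i * lin m A q0 i)) =
    grid_energy m A p q u v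
    + \<alpha> * (\<Sum>i<m. 4 * (p i * (lin m A e i + u i * e i)))
    + \<beta> * (\<Sum>i<m. - 4 * (q i * (lin m A e i + u i * e i)))
    + (\<alpha>\<^sup>2 + \<beta>\<^sup>2) * (\<Sum>i<m. 2 * (e i * (lin m A e i + u i * e i)))
    + \<gamma> * (\<Sum>i<m. - 4 * (v i * e2 i)) + \<gamma>\<^sup>2 * (\<Sum>i<m. - (e2 i)\<^sup>2)
    + 2 * \<alpha> * ((\<Sum>i<m. e i * lin m A p i) - (\<Sum>i<m. p i * lin m A e i))
    - 2 * \<beta> * ((\<Sum>i<m. e i * lin m A q i) - (\<Sum>i<m. q i * lin m A e i))"
    unfolding grid_energy_def sum_distrib_left sum.distrib[symmetric] sum_subtractf[symmetric]
    by (intro sum.cong refl)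
      (simp add: lin_p0 lin_q0, simp add: p0_def q0_def v0_def power2_eq_square algebra_simps)
  show ?thesis
    unfolding energy_step 1 2 el by simp
qed

end

subsection \<open>Random variables with all moments\<close>

context prob_space
begin

text \<open>Measurability refers to \<open>F\<close>, moments to the underlying probability. Having
  all moments makes this set an algebra, so membership survives any number of nonlinear
  steps.\<close>

definition moment_space :: "'a measure \<Rightarrow> ('a \<Rightarrow> real) set" where
  "moment_space F = {X \<in> borel_measurable F. \<forall>k. integrable M (\<lambda>\<omega>. \<bar>X \<omega>\<bar> ^ k)}"

lemma moment_spaceI:
  "X \<in> borel_measurable F \<Longrightarrow> (\<And>k. integrable M (\<lambda>\<omega>. \<bar>X \<omega>\<bar> ^ k)) \<Longrightarrow> X \<in> moment_space F"
  and moment_space_measurable: "X \<in> moment_space F \<Longrightarrow> X \<in> borel_measurable F"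
  and moment_space_abs_power: "X \<in> moment_space F \<Longrightarrow> integrable M (\<lambda>\<omega>. \<bar>X \<omega>\<bar> ^ k)"
  unfolding moment_space_def by blast+

lemma moment_space_mono:
  assumes "subalgebra F' F" "X \<in> moment_space F"
  shows "X \<in> moment_space F'"
  by (intro moment_spaceI measurable_from_subalg[OF assms(1)] moment_space_measurable[OF assms(2)]
      moment_space_abs_power[OF assms(2)])

lemma moment_space_subalgebra:
  "subalgebra M F \<Longrightarrow> X \<in> moment_space F \<Longrightarrow> X \<in> moment_space M"
  by (rule moment_space_mono)

lemma moment_space_integrable:
  assumes "subalgebra M F" "X \<in> moment_space F"
  shows "integrable M X"
proof -
  have X: "X \<in> borel_measurable M"
    by (rule moment_space_measurable[OF moment_space_subalgebra[OF assms]])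
  have "integrable M (\<lambda>\<omega>. \<bar>X \<omega>\<bar>)"
    using moment_space_abs_power[OF assms(2), of 1] unfolding power_one_right .
  then show ?thesis unfolding integrable_abs_iff[OF X] .
qed

text \<open>The majorant may change with the power \<open>k\<close>, which is what sums and products
  require.\<close>

lemma moment_space_bounded_powers:
  assumes F: "subalgebra M F" and X: "X \<in> borel_measurable F"
    and Y: "\<And>k. integrable M (Y k)"
    and le: "\<And>\<omega> k. \<omega> \<in> space M \<Longrightarrow> \<bar>X \<omega>\<bar> ^ k \<le> Y k \<omega>"
  shows "X \<in> moment_space F"
proof (rule moment_spaceI[OF X])
  fix k
  have XM [measurable]: "X \<in> borel_measurable M" using measurable_from_subalg[OF F X] .
  show "integrable M (\<lambda>\<omega>. \<bar>X \<omega>\<bar> ^ k)"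
  proof (rule Bochner_Integration.integrable_bound[OF Y[of k]])
    show "(\<lambda>\<omega>. \<bar>X \<omega>\<bar> ^ k) \<in> borel_measurable M" by measurable
    show "AE \<omega> in M. norm (\<bar>X \<omega>\<bar> ^ k) \<le> norm (Y k \<omega>)"
    proof (rule AE_I2)
      fix \<omega> assume "\<omega> \<in> space M"
      from le[OF this, of k] show "norm (\<bar>X \<omega>\<bar> ^ k) \<le> norm (Y k \<omega>)" by simp
    qed
  qed
qed

lemma moment_space_dominated:
  assumes F: "subalgebra M F" and X: "X \<in> borel_measurable F"
    and Y: "Y \<in> moment_space F'" and le: "\<And>\<omega>. \<omega> \<in> space M \<Longrightarrow> \<bar>X \<omega>\<bar> \<le> Y \<omega>"
  shows "X \<in> moment_space F"
proof (rule moment_space_bounded_powers[OF F X moment_space_abs_power[OF Y]])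
  fix \<omega> k assume "\<omega> \<in> space M"
  from le[OF this] show "\<bar>X \<omega>\<bar> ^ k \<le> \<bar>Y \<omega>\<bar> ^ k" by (intro power_mono) auto
qed

lemma moment_space_cong:
  assumes eq: "\<And>\<omega>. \<omega> \<in> space M \<Longrightarrow> X \<omega> = Y \<omega>" and F: "subalgebra M F" and Y: "Y \<in> moment_space F"
  shows "X \<in> moment_space F"
proof (rule moment_space_bounded_powers[OF F, where Y="\<lambda>k \<omega>. \<bar>Y \<omega>\<bar> ^ k"])
  have "X \<in> borel_measurable F \<longleftrightarrow> Y \<in> borel_measurable F"
    using eq F by (intro measurable_cong) (simp add: subalgebra_def)
  with moment_space_measurable[OF Y] show "X \<in> borel_measurable F" by simp
qed (simp_all add: eq moment_space_abs_power[OF Y])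

lemma moment_space_const [simp]: "(\<lambda>\<omega>. c) \<in> moment_space F"
  by (simp add: moment_space_def)

lemma moment_space_add:
  assumes F: "subalgebra M F" and X: "X \<in> moment_space F" and Y: "Y \<in> moment_space F"
  shows "(\<lambda>\<omega>. X \<omega> + Y \<omega>) \<in> moment_space F"
proof (rule moment_space_bounded_powers[OF F, where Y="\<lambda>k \<omega>. 2 ^ k * (\<bar>X \<omega>\<bar> ^ k + \<bar>Y \<omega>\<bar> ^ k)"])
  note [measurable] = moment_space_measurable[OF X] moment_space_measurable[OF Y]
    moment_space_measurable[OF moment_space_subalgebra[OF F X]]
    moment_space_measurable[OF moment_space_subalgebra[OF F Y]]
  show "(\<lambda>\<omega>. X \<omega> + Y \<omega>) \<in> borel_measurable F" by measurable
  fix k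
  have "\<bar>x + y\<bar> ^ k \<le> 2 ^ k * (\<bar>x\<bar> ^ k + \<bar>y\<bar> ^ k)" for x y :: real
  proof -
    have "\<bar>x + y\<bar> ^ k \<le> (2 * max \<bar>x\<bar> \<bar>y\<bar>) ^ k" by (intro power_mono) auto
    also have "\<dots> = 2 ^ k * (max \<bar>x\<bar> \<bar>y\<bar>) ^ k" by (simp add: power_mult_distrib)
    also have "\<dots> \<le> 2 ^ k * (\<bar>x\<bar> ^ k + \<bar>y\<bar> ^ k)"
      by (intro mult_left_mono) (auto simp: max_def)
    finally show ?thesis .
  qed
  then show "\<bar>X \<omega> + Y \<omega>\<bar> ^ k \<le> 2 ^ k * (\<bar>X \<omega>\<bar> ^ k + \<bar>Y \<omega>\<bar> ^ k)" for \<omega> .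
  show "integrable M (\<lambda>\<omega>. 2 ^ k * (\<bar>X \<omega>\<bar> ^ k + \<bar>Y \<omega>\<bar> ^ k))"
    using moment_space_abs_power[OF X, of k] moment_space_abs_power[OF Y, of k]
    by (intro Bochner_Integration.integrable_add integrable_mult_right)
qed

lemma moment_space_mult:
  assumes F: "subalgebra M F" and X: "X \<in> moment_space F" and Y: "Y \<in> moment_space F"
  shows "(\<lambda>\<omega>. X \<omega> * Y \<omega>) \<in> moment_space F"
proof (rule moment_space_bounded_powers[OF F, where Y="\<lambda>k \<omega>. \<bar>X \<omega>\<bar> ^ (k * 2) + \<bar>Y \<omega>\<bar> ^ (k * 2)"])
  note [measurable] = moment_space_measurable[OF X] moment_space_measurable[OF Y]
    moment_space_measurable[OF moment_space_subalgebra[OF F X]]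
    moment_space_measurable[OF moment_space_subalgebra[OF F Y]]
  show "(\<lambda>\<omega>. X \<omega> * Y \<omega>) \<in> borel_measurable F" by measurable
  fix k
  have "\<bar>x * y\<bar> ^ k \<le> \<bar>x\<bar> ^ (k * 2) + \<bar>y\<bar> ^ (k * 2)" for x y :: real
  proof -
    have "0 \<le> \<bar>x\<bar> ^ k * \<bar>y\<bar> ^ k" by simp
    moreover have "2 * (\<bar>x\<bar> ^ k * \<bar>y\<bar> ^ k) \<le> (\<bar>x\<bar> ^ k)\<^sup>2 + (\<bar>y\<bar> ^ k)\<^sup>2"
      using sum_squares_bound[of "\<bar>x\<bar> ^ k" "\<bar>y\<bar> ^ k"] by simp
    ultimately have "\<bar>x\<bar> ^ k * \<bar>y\<bar> ^ k \<le> (\<bar>x\<bar> ^ k)\<^sup>2 + (\<bar>y\<bar> ^ k)\<^sup>2" by linarith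
    then show ?thesis by (simp add: abs_mult power_mult_distrib power_mult)
  qed
  then show "\<bar>X \<omega> * Y \<omega>\<bar> ^ k \<le> \<bar>X \<omega>\<bar> ^ (k * 2) + \<bar>Y \<omega>\<bar> ^ (k * 2)" for \<omega> .
  show "integrable M (\<lambda>\<omega>. \<bar>X \<omega>\<bar> ^ (k * 2) + \<bar>Y \<omega>\<bar> ^ (k * 2))"
    using moment_space_abs_power[OF X, of "k * 2"] moment_space_abs_power[OF Y, of "k * 2"]
    by (rule Bochner_Integration.integrable_add)
qed

lemma moment_space_minus:
  assumes "subalgebra M F" "X \<in> moment_space F"
  shows "(\<lambda>\<omega>. - X \<omega>) \<in> moment_space F"
  using moment_space_mult[OF assms(1) moment_space_const[of "-1"] assms(2)] by simp

lemma moment_space_diff: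
  assumes "subalgebra M F" "X \<in> moment_space F" "Y \<in> moment_space F"
  shows "(\<lambda>\<omega>. X \<omega> - Y \<omega>) \<in> moment_space F"
  using moment_space_add[OF assms(1,2) moment_space_minus[OF assms(1,3)]] by simp

lemma moment_space_divide:
  assumes "subalgebra M F" "X \<in> moment_space F"
  shows "(\<lambda>\<omega>. X \<omega> / c) \<in> moment_space F"
  using moment_space_mult[OF assms(1) assms(2) moment_space_const[of "1 / c"]] by simp

lemma moment_space_power2:
  assumes "subalgebra M F" "X \<in> moment_space F"
  shows "(\<lambda>\<omega>. (X \<omega>)\<^sup>2) \<in> moment_space F"
  using moment_space_mult[OF assms(1,2,2)] by (simp add: power2_eq_square)

lemma moment_space_sum:
  assumes "subalgebra M F" "\<And>i. i \<in> I \<Longrightarrow> X i \<in> moment_space F"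
  shows "(\<lambda>\<omega>. \<Sum>i\<in>I. X i \<omega>) \<in> moment_space F"
  using assms(2)
proof (induction I rule: infinite_finite_induct)
  case (insert i I)
  then have "(\<lambda>\<omega>. X i \<omega> + (\<Sum>i\<in>I. X i \<omega>)) \<in> moment_space F"
    by (intro moment_space_add assms(1)) simp_all
  with insert show ?case by simp
qed simp_all

lemma moment_space_lin:
  assumes "subalgebra M F" "\<And>i. i < m \<Longrightarrow> (\<lambda>\<omega>. X \<omega> i) \<in> moment_space F"
  shows "(\<lambda>\<omega>. lin m A (X \<omega>) i) \<in> moment_space F"
  unfolding lin_def
  by (intro moment_space_sum moment_space_mult[OF _ moment_space_const] assms) simp

lemmas moment_space_intros = moment_space_add moment_space_mult moment_space_minus moment_space_diff
  moment_space_divide moment_space_power2 moment_space_sum moment_space_lin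

text \<open>Coefficients known from the past are paired with fresh noise. Giving integrability and
  value at once lets a long sum of such products be integrated term by term.\<close>

lemma has_bochner_integral_indep_mult:
  assumes F: "subalgebra M F" and G: "subalgebra M G" and ind: "indep_set (sets F) (sets G)"
    and X: "X \<in> moment_space F" and Y: "Y \<in> moment_space G"
  shows "has_bochner_integral M (\<lambda>\<omega>. Y \<omega> * X \<omega>) (expectation Y * expectation X)"
proof -
  have i: "indep_var borel X borel Y"
    using ind F G moment_space_measurable[OF X] moment_space_measurable[OF Y]
    by (intro indep_var_of_indep_set[of F G]) (auto simp: subalgebra_def)
  note int = moment_space_integrable[OF F X] moment_space_integrable[OF G Y]
  show ?thesis
    using indep_var_integrable[OF i int] indep_var_lebesgue_integral[OF i int]
    by (simp add: has_bochner_integral_iff mult.commute)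
qed

text \<open>The new values are only given implicitly: their measurability comes from Cramer's rule, and
  their moments from the a priori bounds.\<close>

lemma moment_space_scheme_step:
  assumes F: "subalgebra M F"
    and step: "\<And>\<omega>. \<omega> \<in> space M \<Longrightarrow> scheme_step m A dt C1 (\<alpha> \<omega>) (\<beta> \<omega>) (\<gamma> \<omega>) e e2
      (p \<omega>) (q \<omega>) (u \<omega>) (v \<omega>) (p' \<omega>) (q' \<omega>) (u' \<omega>) (v' \<omega>)"
    and noise: "\<alpha> \<in> moment_space F" "\<beta> \<in> moment_space F" "\<gamma> \<in> moment_space F"
    and old: "\<And>i. i < m \<Longrightarrow> (\<lambda>\<omega>. p \<omega> i) \<in> moment_space F" "\<And>i. i < m \<Longrightarrow> (\<lambda>\<omega>. q \<omega> i) \<in> moment_space F"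
      "\<And>i. i < m \<Longrightarrow> (\<lambda>\<omega>. u \<omega> i) \<in> moment_space F" "\<And>i. i < m \<Longrightarrow> (\<lambda>\<omega>. v \<omega> i) \<in> moment_space F"
    and i: "i < m"
  shows "(\<lambda>\<omega>. p' \<omega> i) \<in> moment_space F" "(\<lambda>\<omega>. q' \<omega> i) \<in> moment_space F"
    "(\<lambda>\<omega>. u' \<omega> i) \<in> moment_space F" "(\<lambda>\<omega>. v' \<omega> i) \<in> moment_space F"
proof -
  have sp: "space F = space M" using F by (simp add: subalgebra_def)
  note intros = moment_space_intros[OF F] moment_space_const
  \<comment> \<open>The constants of \<open>scheme_step\<close> exist only for a fixed sample point;
    these copies make their dependence on \<omega> explicit.\<close>
  define p0 where "p0 \<omega> i = p \<omega> i + \<alpha> \<omega> * e i" for \<omega> i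
  define q0 where "q0 \<omega> i = q \<omega> i - \<beta> \<omega> * e i" for \<omega> i
  define r where "r \<omega> i = 2 * dt * (v \<omega> i + \<gamma> \<omega> / 2 * e2 i) + dt\<^sup>2 / 2 * (lin m A (u \<omega>) i - u \<omega> i +
      ((p \<omega> i)\<^sup>2 + (q \<omega> i)\<^sup>2 + 2 * \<alpha> \<omega> * (p \<omega> i * e i) - 2 * \<beta> \<omega> * (q \<omega> i * e i)
        + 2 * C1\<^sup>2 * dt * (e i)\<^sup>2))" for \<omega> i
  define L where "L \<omega> x i = lin m A x i + u' \<omega> i * x i" for \<omega> x i
  define G where "G i j = (if i = j then 1 + dt\<^sup>2 / 4 else 0) + - (dt\<^sup>2 / 4) * A i j" for i j
  define S where "S \<omega> i j = (if i = j then u' \<omega> i else 0) + 1 * A i j" for \<omega> i j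
  define H where "H \<omega> i j = (if i = j then 1 else 0) + (dt / 2)\<^sup>2 * (\<Sum>k<m. S \<omega> i k * S \<omega> k j)" for \<omega> i j
  have *: "coercive m G \<and> coercive m (H \<omega>) \<and>
      (\<forall>i<m. lin m G (\<lambda>j. u' \<omega> j - u \<omega> j) i = r \<omega> i \<and>
        \<bar>u' \<omega> i - u \<omega> i\<bar> \<le> 1 + (\<Sum>i<m. (r \<omega> i)\<^sup>2) \<and>
        lin m (H \<omega>) (p' \<omega>) i = p0 \<omega> i - dt * L \<omega> (q0 \<omega>) i - (dt / 2)\<^sup>2 * L \<omega> (L \<omega> (p0 \<omega>)) i \<and>
        \<bar>p' \<omega> i\<bar> \<le> 1 + (\<Sum>i<m. (p0 \<omega> i)\<^sup>2 + (q0 \<omega> i)\<^sup>2) \<and>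
        q' \<omega> i = q0 \<omega> i + dt / 2 * L \<omega> (\<lambda>j. p' \<omega> j + p0 \<omega> j) i \<and>
        v' \<omega> i = v \<omega> i + dt / 2 * ((lin m A (u' \<omega>) i + lin m A (u \<omega>) i) / 2 - (u' \<omega> i + u \<omega> i) / 2
          + (p \<omega> i)\<^sup>2 + (q \<omega> i)\<^sup>2) + \<gamma> \<omega> / 2 * e2 i
          + dt * (\<alpha> \<omega> * (p \<omega> i * e i) - \<beta> \<omega> * (q \<omega> i * e i) + dt * C1\<^sup>2 * (e i)\<^sup>2))"
    if \<omega>: "\<omega> \<in> space M" for \<omega>
  proof -
    interpret s: scheme_step m A dt C1 "\<alpha> \<omega>" "\<beta> \<omega>" "\<gamma> \<omega>" e e2 "p \<omega>" "q \<omega>" "u \<omega>" "v \<omega>"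
        "p' \<omega>" "q' \<omega>" "u' \<omega>" "v' \<omega>"
      by (rule step[OF \<omega>])
    have eqs: "s.p0 = p0 \<omega>" "s.q0 = q0 \<omega>" "s.L = L \<omega>" "s.L_mat = S \<omega>" "s.U_mat = G"
      by (auto intro!: ext simp: s.p0_def p0_def s.q0_def q0_def s.L_def L_def s.L_mat_def S_def
          s.U_mat_def G_def)
    have eqs': "s.r = r \<omega>" "s.P_mat = H \<omega>"
      by (auto intro!: ext simp: s.r_def r_def s.v0_def s.F_def s.P_mat_def H_def eqs)
    show ?thesis
    proof (intro conjI allI impI)
      show "coercive m G" using s.coercive_U_mat unfolding eqs .
      show "coercive m (H \<omega>)" using s.coercive_P_mat unfolding eqs' .
      fix i assume i: "i < m"
      show "lin m G (\<lambda>j. u' \<omega> j - u \<omega> j) i = r \<omega> i" using s.U_equation[OF i] unfolding eqs eqs' .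
      show "\<bar>u' \<omega> i - u \<omega> i\<bar> \<le> 1 + (\<Sum>i<m. (r \<omega> i)\<^sup>2)" using s.U_bound[OF i] unfolding eqs' .
      show "lin m (H \<omega>) (p' \<omega>) i = p0 \<omega> i - dt * L \<omega> (q0 \<omega>) i - (dt / 2)\<^sup>2 * L \<omega> (L \<omega> (p0 \<omega>)) i"
        using s.P_implicit[OF i] unfolding eqs eqs' .
      show "\<bar>p' \<omega> i\<bar> \<le> 1 + (\<Sum>i<m. (p0 \<omega> i)\<^sup>2 + (q0 \<omega> i)\<^sup>2)" using s.P_bound[OF i] unfolding eqs .
      show "q' \<omega> i = q0 \<omega> i + dt / 2 * L \<omega> (\<lambda>j. p' \<omega> j + p0 \<omega> j) i"
        using s.Q0[OF i] unfolding eqs by simp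
      show "v' \<omega> i = v \<omega> i + dt / 2 * ((lin m A (u' \<omega>) i + lin m A (u \<omega>) i) / 2 - (u' \<omega> i + u \<omega> i) / 2
          + (p \<omega> i)\<^sup>2 + (q \<omega> i)\<^sup>2) + \<gamma> \<omega> / 2 * e2 i
          + dt * (\<alpha> \<omega> * (p \<omega> i * e i) - \<beta> \<omega> * (q \<omega> i * e i) + dt * C1\<^sup>2 * (e i)\<^sup>2)"
        using s.V[OF i] unfolding lin_simps .
    qed
  qed
  \<comment> \<open>\<open>G\<close> does not depend on \<omega>, so one sample point suffices, and
    the space of a probability measure is nonempty.\<close>
  have coer: "coercive m G" using * not_empty by blast
  have coer': "coercive m (H \<omega>)" if "\<omega> \<in> space M" for \<omega> using *[OF that] by blast
  have eqU: "lin m G (\<lambda>j. u' \<omega> j - u \<omega> j) i = r \<omega> i"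
    and bdU: "\<bar>u' \<omega> i - u \<omega> i\<bar> \<le> 1 + (\<Sum>i<m. (r \<omega> i)\<^sup>2)"
    and eqP: "lin m (H \<omega>) (p' \<omega>) i = p0 \<omega> i - dt * L \<omega> (q0 \<omega>) i - (dt / 2)\<^sup>2 * L \<omega> (L \<omega> (p0 \<omega>)) i"
    and bdP: "\<bar>p' \<omega> i\<bar> \<le> 1 + (\<Sum>i<m. (p0 \<omega> i)\<^sup>2 + (q0 \<omega> i)\<^sup>2)"
    and eqQ: "q' \<omega> i = q0 \<omega> i + dt / 2 * L \<omega> (\<lambda>j. p' \<omega> j + p0 \<omega> j) i"
    and eqV: "v' \<omega> i = v \<omega> i + dt / 2 * ((lin m A (u' \<omega>) i + lin m A (u \<omega>) i) / 2 - (u' \<omega> i + u \<omega> i) / 2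
          + (p \<omega> i)\<^sup>2 + (q \<omega> i)\<^sup>2) + \<gamma> \<omega> / 2 * e2 i
          + dt * (\<alpha> \<omega> * (p \<omega> i * e i) - \<beta> \<omega> * (q \<omega> i * e i) + dt * C1\<^sup>2 * (e i)\<^sup>2)"
    if "\<omega> \<in> space M" "i < m" for \<omega> i
    using *[OF that(1)] that(2) by blast+
  have p0: "(\<lambda>\<omega>. p0 \<omega> i) \<in> moment_space F" and q0: "(\<lambda>\<omega>. q0 \<omega> i) \<in> moment_space F"
    and r: "(\<lambda>\<omega>. r \<omega> i) \<in> moment_space F" if "i < m" for i
    unfolding p0_def q0_def r_def by (intro intros noise old that)+
  \<comment> \<open>The order matters: \<open>u'\<close> comes first because it enters the
    coefficients of the system for \<open>p'\<close>; then \<open>q'\<close> and \<open>v'\<close>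
    follow from explicit formulas.\<close>
  have u: "(\<lambda>\<omega>. u' \<omega> i) \<in> moment_space F" if i: "i < m" for i
  proof -
    have "(\<lambda>\<omega>. u' \<omega> i - u \<omega> i) \<in> moment_space F"
    proof (rule moment_space_dominated[OF F])
      show "(\<lambda>\<omega>. u' \<omega> i - u \<omega> i) \<in> borel_measurable F"
        by (rule measurable_linear_solution[where G="\<lambda>_. G" and b=r and m=m])
          (simp_all add: sp coer eqU[unfolded lin_def] i moment_space_measurable[OF r])
      show "(\<lambda>\<omega>. 1 + (\<Sum>i<m. (r \<omega> i)\<^sup>2)) \<in> moment_space F"
        by (intro intros r) auto
    qed (rule bdU[OF _ i])
    from moment_space_add[OF F this old(3)[OF i]] show ?thesis by simp
  qed
  have L: "(\<lambda>\<omega>. L \<omega> (X \<omega>) i) \<in> moment_space F"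
    if "\<And>i. i < m \<Longrightarrow> (\<lambda>\<omega>. X \<omega> i) \<in> moment_space F" "i < m" for X i
    unfolding L_def using that by (intro intros u) auto
  have p: "(\<lambda>\<omega>. p' \<omega> i) \<in> moment_space F" if i: "i < m" for i
  proof (rule moment_space_dominated[OF F])
    have S: "(\<lambda>\<omega>. S \<omega> i j) \<in> borel_measurable F" if "i < m" for i j
      using moment_space_measurable[OF u[OF that]] by (simp add: S_def)
    show "(\<lambda>\<omega>. p' \<omega> i) \<in> borel_measurable F"
    proof (rule measurable_linear_solution[where G=H and m=m])
      show "(\<lambda>\<omega>. H \<omega> i j) \<in> borel_measurable F" if "i < m" for i j
        unfolding H_def using S that by (intro borel_measurable_add borel_measurable_times borel_measurable_sum) auto
      show "(\<lambda>\<omega>. p0 \<omega> i - dt * L \<omega> (q0 \<omega>) i - (dt / 2)\<^sup>2 * L \<omega> (L \<omega> (p0 \<omega>)) i) \<in> borel_measurable F"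
        if "i < m" for i
        by (intro moment_space_measurable intros L p0 q0 that)
    qed (simp_all add: sp coer' eqP[unfolded lin_def] i)
    show "(\<lambda>\<omega>. 1 + (\<Sum>i<m. (p0 \<omega> i)\<^sup>2 + (q0 \<omega> i)\<^sup>2)) \<in> moment_space F"
      by (intro intros p0 q0) auto
  qed (rule bdP[OF _ i])
  show "(\<lambda>\<omega>. q' \<omega> i) \<in> moment_space F"
    by (rule moment_space_cong[OF _ F], erule eqQ[OF _ i], intro intros L p q0 p0 i)
  show "(\<lambda>\<omega>. v' \<omega> i) \<in> moment_space F"
    by (rule moment_space_cong[OF _ F], erule eqV[OF _ i], intro intros noise old u i)
  show "(\<lambda>\<omega>. p' \<omega> i) \<in> moment_space F" "(\<lambda>\<omega>. u' \<omega> i) \<in> moment_space F" using p u i by auto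
qed

text \<open>\<open>F\<close> is the past and \<open>G\<close> the noise of the step. In
  \<open>energy_increment\<close> each noise monomial is independent of its coefficient, so the
  expectations factor, and only the terms with \<alpha>^2 + \<beta>^2 and \<gamma>^2 can
  contribute.\<close>

lemma expectation_energy_step:
  assumes F: "subalgebra M F" and G: "subalgebra M G" and ind: "indep_set (sets F) (sets G)"
    and step: "\<And>\<omega>. \<omega> \<in> space M \<Longrightarrow> scheme_step m A dt C1 (\<alpha> \<omega>) (\<beta> \<omega>) (\<gamma> \<omega>) e e2
      (p \<omega>) (q \<omega>) (u \<omega>) (v \<omega>) (p' \<omega>) (q' \<omega>) (u' \<omega>) (v' \<omega>)"
    and old: "\<And>i. i < m \<Longrightarrow> (\<lambda>\<omega>. p \<omega> i) \<in> moment_space F" "\<And>i. i < m \<Longrightarrow> (\<lambda>\<omega>. q \<omega> i) \<in> moment_space F"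
      "\<And>i. i < m \<Longrightarrow> (\<lambda>\<omega>. u \<omega> i) \<in> moment_space F" "\<And>i. i < m \<Longrightarrow> (\<lambda>\<omega>. v \<omega> i) \<in> moment_space F"
    and noise: "\<alpha> \<in> moment_space G" "\<beta> \<in> moment_space G" "\<gamma> \<in> moment_space G"
    and \<xi>: "\<And>\<omega>. \<xi> \<omega> = (\<alpha> \<omega>)\<^sup>2 + (\<beta> \<omega>)\<^sup>2 - 2 * C1\<^sup>2 * dt"
    and mean: "expectation \<alpha> = 0" "expectation \<beta> = 0" "expectation \<gamma> = 0" "expectation \<xi> = 0"
    and \<alpha>\<beta>: "expectation (\<lambda>\<omega>. (\<alpha> \<omega>)\<^sup>2 + (\<beta> \<omega>)\<^sup>2) = 2 * C1\<^sup>2 * dt"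
    and \<gamma>\<gamma>: "expectation (\<lambda>\<omega>. (\<gamma> \<omega>)\<^sup>2) = C2\<^sup>2 * dt"
    and uncorrelated: "expectation (\<lambda>\<omega>. \<alpha> \<omega> * \<xi> \<omega>) = 0" "expectation (\<lambda>\<omega>. \<beta> \<omega> * \<xi> \<omega>) = 0"
      "expectation (\<lambda>\<omega>. \<gamma> \<omega> * \<xi> \<omega>) = 0"
  shows "expectation (\<lambda>\<omega>. grid_energy m A (p' \<omega>) (q' \<omega>) (u' \<omega>) (v' \<omega>)) =
      expectation (\<lambda>\<omega>. grid_energy m A (p \<omega>) (q \<omega>) (u \<omega>) (v \<omega>))
      + 4 * C1\<^sup>2 * dt * (\<Sum>i<m. e i * lin m A e i)
      + 4 * C1\<^sup>2 * dt * expectation (\<lambda>\<omega>. \<Sum>i<m. u \<omega> i * (e i)\<^sup>2)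
      - C2\<^sup>2 * dt * (\<Sum>i<m. (e2 i)\<^sup>2)"
proof -
  note intros = moment_space_intros[OF F] moment_space_const
  define G0 where "G0 i j = (if i = j then 1 + dt\<^sup>2 / 4 else 0) + - (dt\<^sup>2 / 4) * A i j" for i j
  \<comment> \<open>\<open>G0\<close> is deterministic, so a single sample point yields its
    coercivity, and the solution \<open>w\<close> is a fixed vector. This keeps the coefficients
    below measurable with respect to the past.\<close>
  have "coercive m G0"
  proof -
    obtain \<omega>0 where \<omega>0: "\<omega>0 \<in> space M" using not_empty by blast
    interpret s: scheme_step m A dt C1 "\<alpha> \<omega>0" "\<beta> \<omega>0" "\<gamma> \<omega>0" e e2 "p \<omega>0" "q \<omega>0" "u \<omega>0" "v \<omega>0"
          "p' \<omega>0" "q' \<omega>0" "u' \<omega>0" "v' \<omega>0"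
      by (rule step[OF \<omega>0])
    have "s.U_mat = G0" by (intro ext) (simp add: s.U_mat_def G0_def)
    with s.coercive_U_mat show ?thesis by simp
  qed
  from coercive_solution[OF this, where b="\<lambda>i. (e i)\<^sup>2"]
  obtain w where w: "\<And>i. i < m \<Longrightarrow> lin m G0 w i = (e i)\<^sup>2"
    unfolding lin_def by blast
  define X1 where "X1 \<omega> = (\<Sum>i<m. 4 * (p \<omega> i * (lin m A e i + u \<omega> i * e i)))" for \<omega>
  define X2 where "X2 \<omega> = (\<Sum>i<m. - 4 * (q \<omega> i * (lin m A e i + u \<omega> i * e i)))" for \<omega>
  define X3 where "X3 \<omega> = (\<Sum>i<m. 2 * (e i * (lin m A e i + u \<omega> i * e i)))" for \<omega>
  define X4 where "X4 \<omega> = (\<Sum>i<m. - 4 * (v \<omega> i * e2 i))" for \<omega>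
  \<comment> \<open>\<open>X5\<close> and \<open>X9\<close> are constants written as random
    variables, so that the product rule treats all terms alike.\<close>
  define X5 where "X5 = (\<lambda>\<omega>::'a. \<Sum>i<m. - (e2 i)\<^sup>2)"
  define X6 where "X6 \<omega> = (\<Sum>i<m. 2 * w i * (2 * dt * v \<omega> i + dt\<^sup>2 / 2 *
          (lin m A (u \<omega>) i - u \<omega> i + (p \<omega> i)\<^sup>2 + (q \<omega> i)\<^sup>2 + 2 * C1\<^sup>2 * dt * (e i)\<^sup>2)))" for \<omega>
  define X7 where "X7 \<omega> = (\<Sum>i<m. 2 * w i * (dt\<^sup>2 * (p \<omega> i * e i)))" for \<omega>
  define X8 where "X8 \<omega> = (\<Sum>i<m. - 2 * w i * (dt\<^sup>2 * (q \<omega> i * e i)))" for \<omega>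
  define X9 where "X9 = (\<lambda>\<omega>::'a. \<Sum>i<m. 2 * w i * (dt * e2 i))"
  define E where "E \<omega> = grid_energy m A (p \<omega>) (q \<omega>) (u \<omega>) (v \<omega>)" for \<omega>
  have energy: "grid_energy m A (p' \<omega>) (q' \<omega>) (u' \<omega>) (v' \<omega>) =
      E \<omega> + \<alpha> \<omega> * X1 \<omega> + \<beta> \<omega> * X2 \<omega> + ((\<alpha> \<omega>)\<^sup>2 + (\<beta> \<omega>)\<^sup>2) * X3 \<omega> + \<gamma> \<omega> * X4 \<omega> + (\<gamma> \<omega>)\<^sup>2 * X5 \<omega>
      + \<xi> \<omega> * X6 \<omega> + \<alpha> \<omega> * \<xi> \<omega> * X7 \<omega> + \<beta> \<omega> * \<xi> \<omega> * X8 \<omega> + \<gamma> \<omega> * \<xi> \<omega> * X9 \<omega>"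
    if \<omega>: "\<omega> \<in> space M" for \<omega>
  proof -
    interpret s: scheme_step m A dt C1 "\<alpha> \<omega>" "\<beta> \<omega>" "\<gamma> \<omega>" e e2 "p \<omega>" "q \<omega>" "u \<omega>" "v \<omega>"
        "p' \<omega>" "q' \<omega>" "u' \<omega>" "v' \<omega>"
      by (rule step[OF \<omega>])
    have U_mat: "s.U_mat = G0" by (intro ext) (simp add: s.U_mat_def G0_def)
    have \<xi>': "s.\<xi> = \<xi> \<omega>" by (simp add: s.\<xi>_def \<xi>)
    show ?thesis
      unfolding E_def X1_def X2_def X3_def X4_def X5_def X6_def X7_def X8_def X9_def
      using s.energy_increment[unfolded U_mat \<xi>', OF w] .
  qed
  have XF: "X1 \<in> moment_space F" "X2 \<in> moment_space F" "X3 \<in> moment_space F" "X4 \<in> moment_space F"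
    "X5 \<in> moment_space F" "X6 \<in> moment_space F" "X7 \<in> moment_space F" "X8 \<in> moment_space F"
    "X9 \<in> moment_space F" and EF: "E \<in> moment_space F"
    unfolding X1_def[abs_def] X2_def[abs_def] X3_def[abs_def] X4_def[abs_def] X5_def
      X6_def[abs_def] X7_def[abs_def] X8_def[abs_def] X9_def E_def[abs_def] grid_energy_def
    by (intro intros old; simp)+
  have \<xi>G: "\<xi> \<in> moment_space G"
    unfolding \<xi>[abs_def] by (intro moment_space_intros[OF G] moment_space_const noise)
  have NG: "(\<lambda>\<omega>. (\<alpha> \<omega>)\<^sup>2 + (\<beta> \<omega>)\<^sup>2) \<in> moment_space G" "(\<lambda>\<omega>. (\<gamma> \<omega>)\<^sup>2) \<in> moment_space G"
    "(\<lambda>\<omega>. \<alpha> \<omega> * \<xi> \<omega>) \<in> moment_space G" "(\<lambda>\<omega>. \<beta> \<omega> * \<xi> \<omega>) \<in> moment_space G"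
    "(\<lambda>\<omega>. \<gamma> \<omega> * \<xi> \<omega>) \<in> moment_space G"
    by (intro moment_space_intros[OF G] moment_space_const noise \<xi>G)+
  note hb = has_bochner_integral_indep_mult[OF F G ind]
  \<comment> \<open>The vanishing means stay visible as factors 0, so that the value is literally
    the sum of the values given by the product rule.\<close>
  have "has_bochner_integral M (\<lambda>\<omega>. E \<omega> + \<alpha> \<omega> * X1 \<omega> + \<beta> \<omega> * X2 \<omega> + ((\<alpha> \<omega>)\<^sup>2 + (\<beta> \<omega>)\<^sup>2) * X3 \<omega>
      + \<gamma> \<omega> * X4 \<omega> + (\<gamma> \<omega>)\<^sup>2 * X5 \<omega>
      + \<xi> \<omega> * X6 \<omega> + \<alpha> \<omega> * \<xi> \<omega> * X7 \<omega> + \<beta> \<omega> * \<xi> \<omega> * X8 \<omega> + \<gamma> \<omega> * \<xi> \<omega> * X9 \<omega>)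
      (expectation E + 0 * expectation X1 + 0 * expectation X2 + 2 * C1\<^sup>2 * dt * expectation X3
       + 0 * expectation X4 + C2\<^sup>2 * dt * expectation X5 + 0 * expectation X6 + 0 * expectation X7
       + 0 * expectation X8 + 0 * expectation X9)"
    using hb[OF XF(1) noise(1)] hb[OF XF(2) noise(2)] hb[OF XF(3) NG(1)] hb[OF XF(4) noise(3)]
      hb[OF XF(5) NG(2)] hb[OF XF(6) \<xi>G] hb[OF XF(7) NG(3)] hb[OF XF(8) NG(4)] hb[OF XF(9) NG(5)]
      has_bochner_integral_integrable[OF moment_space_integrable[OF F EF]]
    unfolding mean \<alpha>\<beta> \<gamma>\<gamma> uncorrelated by (intro has_bochner_integral_add)
  then have "expectation (\<lambda>\<omega>. E \<omega> + \<alpha> \<omega> * X1 \<omega> + \<beta> \<omega> * X2 \<omega> + ((\<alpha> \<omega>)\<^sup>2 + (\<beta> \<omega>)\<^sup>2) * X3 \<omega>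
      + \<gamma> \<omega> * X4 \<omega> + (\<gamma> \<omega>)\<^sup>2 * X5 \<omega>
      + \<xi> \<omega> * X6 \<omega> + \<alpha> \<omega> * \<xi> \<omega> * X7 \<omega> + \<beta> \<omega> * \<xi> \<omega> * X8 \<omega> + \<gamma> \<omega> * \<xi> \<omega> * X9 \<omega>) =
      expectation E + 2 * C1\<^sup>2 * dt * expectation X3 + C2\<^sup>2 * dt * expectation X5"
    by (simp add: has_bochner_integral_integral_eq)
  moreover have "expectation X5 = - (\<Sum>i<m. (e2 i)\<^sup>2)"
    by (simp add: X5_def sum_negf prob_space)
  moreover have "expectation X3 = 2 * (\<Sum>i<m. e i * lin m A e i) + 2 * expectation (\<lambda>\<omega>. \<Sum>i<m. u \<omega> i * (e i)\<^sup>2)"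
  proof -
    have X3: "X3 = (\<lambda>\<omega>. 2 * (\<Sum>i<m. e i * lin m A e i) + 2 * (\<Sum>i<m. u \<omega> i * (e i)\<^sup>2))"
      unfolding X3_def[abs_def] sum_distrib_left sum.distrib[symmetric]
      by (intro ext sum.cong refl) (simp add: power2_eq_square algebra_simps)
    have "(\<lambda>\<omega>. \<Sum>i<m. u \<omega> i * (e i)\<^sup>2) \<in> moment_space F"
      by (intro intros old; simp)
    from moment_space_integrable[OF F this] show ?thesis
      unfolding X3 by (simp add: prob_space)
  qed
  moreover have "expectation (\<lambda>\<omega>. grid_energy m A (p' \<omega>) (q' \<omega>) (u' \<omega>) (v' \<omega>)) =
     expectation (\<lambda>\<omega>. E \<omega> + \<alpha> \<omega> * X1 \<omega> + \<beta> \<omega> * X2 \<omega> + ((\<alpha> \<omega>)\<^sup>2 + (\<beta> \<omega>)\<^sup>2) * X3 \<omega>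
      + \<gamma> \<omega> * X4 \<omega> + (\<gamma> \<omega>)\<^sup>2 * X5 \<omega>
      + \<xi> \<omega> * X6 \<omega> + \<alpha> \<omega> * \<xi> \<omega> * X7 \<omega> + \<beta> \<omega> * \<xi> \<omega> * X8 \<omega> + \<gamma> \<omega> * \<xi> \<omega> * X9 \<omega>)"
    by (intro Bochner_Integration.integral_cong refl energy)
  moreover have "expectation E = expectation (\<lambda>\<omega>. grid_energy m A (p \<omega>) (q \<omega>) (u \<omega>) (v \<omega>))"
    by (simp add: E_def[abs_def])
  ultimately show ?thesis by (simp add: algebra_simps)
qed

section \<open>Moments of the Gaussian increments\<close>

lemma centered_normal_moments:
  assumes X: "distributed M lborel X (normal_density 0 (sqrt dt))" and dt: "dt > 0"
  shows "X \<in> borel_measurable M" "integrable M (\<lambda>\<omega>. \<bar>X \<omega>\<bar> ^ k)"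
    "expectation X = 0" "expectation (\<lambda>\<omega>. (X \<omega>)\<^sup>2) = dt" "expectation (\<lambda>\<omega>. X \<omega> ^ 3) = 0"
proof -
  have \<sigma>: "0 < sqrt dt" using dt by simp
  have nonneg: "0 \<le> normal_density 0 (sqrt dt) x" for x by simp
  show "X \<in> borel_measurable M" using distributed_measurable[OF X] by simp
  show "integrable M (\<lambda>\<omega>. \<bar>X \<omega>\<bar> ^ k)"
    using distributed_integrable[OF X, of "\<lambda>x. \<bar>x\<bar> ^ k"] integrable_normal_moment_abs[OF \<sigma>, of 0 k] nonneg
    by simp
  have E: "expectation (\<lambda>\<omega>. g (X \<omega>)) = (\<integral>x. normal_density 0 (sqrt dt) x * g x \<partial>lborel)"
    if "g \<in> borel_measurable borel" for g :: "real \<Rightarrow> real"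
    using distributed_integral[OF X, of g] that nonneg by simp
  show "expectation X = 0"
    using E[of "\<lambda>x. x"] integral_normal_moment_odd[OF \<sigma>, of 0 0] by simp
  show "expectation (\<lambda>\<omega>. (X \<omega>)\<^sup>2) = dt"
    using E[of "\<lambda>x. x\<^sup>2"] integral_normal_moment_even[OF \<sigma>, of 0 1] dt by simp
  show "expectation (\<lambda>\<omega>. X \<omega> ^ 3) = 0"
    using E[of "\<lambda>x. x ^ 3"] integral_normal_moment_odd[OF \<sigma>, of 0 1] by (simp add: eval_nat_numeral)
qed

text \<open>The subtracted constant in \<xi> is the sum of the variances of \<alpha> and \<beta>.
  Multiplied by \<xi>, each noise variable becomes a combination of terms X^3, X * Y^2 and X with X,
  Y independent and centred normal; their means vanish because odd moments do.\<close>

lemma noise_moments: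
  fixes X :: "'i \<Rightarrow> 'a \<Rightarrow> real" and C1 C2 dt :: real
  assumes ind: "indep_vars (\<lambda>_. borel) X I" and I: "i \<in> I" "j \<in> I" "k \<in> I" "i \<noteq> j" "i \<noteq> k" "j \<noteq> k"
    and normal: "\<And>l. l \<in> I \<Longrightarrow> distributed M lborel (X l) (normal_density 0 (sqrt dt))"
    and dt: "dt > 0"
    and \<alpha>: "\<And>\<omega>. \<alpha> \<omega> = C1 * X i \<omega>" and \<beta>: "\<And>\<omega>. \<beta> \<omega> = C1 * X j \<omega>" and \<gamma>: "\<And>\<omega>. \<gamma> \<omega> = C2 * X k \<omega>"
    and \<xi>: "\<And>\<omega>. \<xi> \<omega> = (\<alpha> \<omega>)\<^sup>2 + (\<beta> \<omega>)\<^sup>2 - 2 * C1\<^sup>2 * dt"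
  shows "expectation \<alpha> = 0" "expectation \<beta> = 0" "expectation \<gamma> = 0" "expectation \<xi> = 0"
    "expectation (\<lambda>\<omega>. (\<alpha> \<omega>)\<^sup>2 + (\<beta> \<omega>)\<^sup>2) = 2 * C1\<^sup>2 * dt"
    "expectation (\<lambda>\<omega>. (\<gamma> \<omega>)\<^sup>2) = C2\<^sup>2 * dt"
    "expectation (\<lambda>\<omega>. \<alpha> \<omega> * \<xi> \<omega>) = 0" "expectation (\<lambda>\<omega>. \<beta> \<omega> * \<xi> \<omega>) = 0"
    "expectation (\<lambda>\<omega>. \<gamma> \<omega> * \<xi> \<omega>) = 0"
proof -
  note mom = centered_normal_moments[OF normal dt]
  have sub: "subalgebra M (generated M X {l})" if "l \<in> I" for l
    using mom(1) that by (intro subalgebra_generated) auto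
  have XG: "X l \<in> moment_space (generated M X {l})" if "l \<in> I" for l
    using measurable_generated[of l "{l}" X M] mom(2)[OF that] by (intro moment_spaceI) auto
  have XM: "X l \<in> moment_space M" if "l \<in> I" for l
    using mom(1,2)[OF that] by (intro moment_spaceI)
  have triv: "subalgebra M M" by (simp add: subalgebra_def)
  have int1: "integrable M (X l)" and int2: "integrable M (\<lambda>\<omega>. (X l \<omega>)\<^sup>2)"
    and int3: "integrable M (\<lambda>\<omega>. X l \<omega> ^ 3)" if "l \<in> I" for l
    using moment_space_integrable[OF triv XM[OF that]]
      moment_space_integrable[OF triv moment_space_power2[OF triv XM[OF that]]]
      moment_space_integrable[OF triv moment_space_mult[OF triv XM[OF that] moment_space_power2[OF triv XM[OF that]]]]
    by (simp_all add: power2_eq_square power3_eq_cube mult.assoc)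
  have cross: "has_bochner_integral M (\<lambda>\<omega>. X l \<omega> * (X l' \<omega>)\<^sup>2) 0"
    if "l \<in> I" "l' \<in> I" "l \<noteq> l'" for l l'
  proof -
    have "indep_set (sets (generated M X {l'})) (sets (generated M X {l}))"
      using that by (intro indep_set_generated[OF ind]) auto
    from has_bochner_integral_indep_mult[OF sub sub this moment_space_power2[OF sub XG] XG] that
    show ?thesis by (simp add: mom(3))
  qed
  have mixed: "integrable M (\<lambda>\<omega>. X l \<omega> * (X l' \<omega>)\<^sup>2)" "expectation (\<lambda>\<omega>. X l \<omega> * (X l' \<omega>)\<^sup>2) = 0"
    if "l \<in> I" "l' \<in> I" "l \<noteq> l'" for l l'
    using cross[OF that] by (simp_all add: has_bochner_integral_iff)
  show "expectation \<alpha> = 0" "expectation \<beta> = 0" "expectation \<gamma> = 0"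
    unfolding \<alpha>[abs_def] \<beta>[abs_def] \<gamma>[abs_def] using I mom(3) by simp_all
  show "expectation \<xi> = 0"
    unfolding \<xi>[abs_def] \<alpha> \<beta> using I mom(4) int2 by (simp add: power_mult_distrib prob_space)
  show "expectation (\<lambda>\<omega>. (\<alpha> \<omega>)\<^sup>2 + (\<beta> \<omega>)\<^sup>2) = 2 * C1\<^sup>2 * dt"
    using I mom(4) int2 by (simp add: \<alpha> \<beta> power_mult_distrib)
  show "expectation (\<lambda>\<omega>. (\<gamma> \<omega>)\<^sup>2) = C2\<^sup>2 * dt"
    using I mom(4) by (simp add: \<gamma> power_mult_distrib)
  have "(\<lambda>\<omega>. \<alpha> \<omega> * \<xi> \<omega>) = (\<lambda>\<omega>. C1 ^ 3 * (X i \<omega> ^ 3 + X i \<omega> * (X j \<omega>)\<^sup>2 - 2 * dt * X i \<omega>))"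
    by (simp add: \<xi> \<alpha> \<beta> fun_eq_iff power2_eq_square power3_eq_cube algebra_simps)
  then show "expectation (\<lambda>\<omega>. \<alpha> \<omega> * \<xi> \<omega>) = 0"
    using I mom(3,5) int1 int3 mixed by simp
  have "(\<lambda>\<omega>. \<beta> \<omega> * \<xi> \<omega>) = (\<lambda>\<omega>. C1 ^ 3 * (X j \<omega> ^ 3 + X j \<omega> * (X i \<omega>)\<^sup>2 - 2 * dt * X j \<omega>))"
    by (simp add: \<xi> \<alpha> \<beta> fun_eq_iff power2_eq_square power3_eq_cube algebra_simps)
  then show "expectation (\<lambda>\<omega>. \<beta> \<omega> * \<xi> \<omega>) = 0"
    using I mom(3,5) int1 int3 mixed by simp
  have "(\<lambda>\<omega>. \<gamma> \<omega> * \<xi> \<omega>) =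
      (\<lambda>\<omega>. C2 * C1\<^sup>2 * (X k \<omega> * (X i \<omega>)\<^sup>2 + X k \<omega> * (X j \<omega>)\<^sup>2 - 2 * dt * X k \<omega>))"
    by (simp add: \<gamma> \<xi> \<alpha> \<beta> fun_eq_iff power2_eq_square algebra_simps)
  then show "expectation (\<lambda>\<omega>. \<gamma> \<omega> * \<xi> \<omega>) = 0"
    using I mom(3) int1 mixed by simp
qed

end

subsection \<open>The discrete Laplacian and energy\<close>

text \<open>Off-diagonal products are bounded by |x y| <= (x^2 + y^2) / 2. After symmetrisation the
  form is at most the sum of the squares weighted by the row sums of \<open>D\<close>, which
  \<open>dominant\<close> makes nonpositive.\<close>

lemma diagonally_dominant_nonpos:
  assumes sym: "\<And>i j. A i j = A j i"
    and dominant: "\<And>i. i < m \<Longrightarrow> (\<Sum>j<m. if i = j then A i j else \<bar>A i j\<bar>) \<le> 0"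
  shows "(\<Sum>i<m. x i * lin m A x i) \<le> 0"
proof -
  define D where "D i j = (if i = j then A i j else \<bar>A i j\<bar>)" for i j
  have D_sym: "D i j = D j i" for i j using sym[of i j] by (simp add: D_def)
  have le: "x i * (A i j * x j) \<le> D i j * ((x i)\<^sup>2 / 2) + D i j * ((x j)\<^sup>2 / 2)" for i j
  proof (cases "i = j")
    case True
    then show ?thesis by (simp add: D_def power2_eq_square)
  next
    case False
    have "x i * (A i j * x j) \<le> \<bar>A i j\<bar> * (\<bar>x i\<bar> * \<bar>x j\<bar>)"
      by (rule order_trans[OF abs_ge_self]) (simp add: abs_mult)
    also have "\<dots> \<le> \<bar>A i j\<bar> * ((x i)\<^sup>2 / 2 + (x j)\<^sup>2 / 2)"
      using sum_squares_bound[of "\<bar>x i\<bar>" "\<bar>x j\<bar>"] by (intro mult_left_mono) auto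
    finally show ?thesis using False by (simp add: D_def distrib_left)
  qed
  have "(\<Sum>i<m. x i * lin m A x i) = (\<Sum>i<m. \<Sum>j<m. x i * (A i j * x j))"
    by (simp add: lin_def sum_distrib_left)
  also have "\<dots> \<le> (\<Sum>i<m. \<Sum>j<m. D i j * ((x i)\<^sup>2 / 2) + D i j * ((x j)\<^sup>2 / 2))"
    by (intro sum_mono le)
  also have "\<dots> = (\<Sum>i<m. \<Sum>j<m. D i j * ((x i)\<^sup>2 / 2)) + (\<Sum>i<m. \<Sum>j<m. D i j * ((x j)\<^sup>2 / 2))"
    by (simp add: sum.distrib)
  also have "(\<Sum>i<m. \<Sum>j<m. D i j * ((x j)\<^sup>2 / 2)) = (\<Sum>i<m. \<Sum>j<m. D i j * ((x i)\<^sup>2 / 2))"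
    by (subst sum.swap) (intro sum.cong refl, simp add: D_sym)
  also have "(\<Sum>i<m. \<Sum>j<m. D i j * ((x i)\<^sup>2 / 2)) + (\<Sum>i<m. \<Sum>j<m. D i j * ((x i)\<^sup>2 / 2)) =
      (\<Sum>i<m. (\<Sum>j<m. D i j) * (x i)\<^sup>2)"
    unfolding sum.distrib[symmetric] sum_distrib_right by (intro sum.cong refl) simp
  also have "\<dots> \<le> 0"
  proof (rule sum_nonpos)
    fix i assume "i \<in> {..<m}"
    then show "(\<Sum>j<m. D i j) * (x i)\<^sup>2 \<le> 0"
      using dominant[of i] unfolding D_def by (intro mult_nonpos_nonneg) simp_all
  qed
  finally show ?thesis .
qed

text \<open>Defined for all indices and independently of the dimension, so that symmetry holds
  without range conditions, as \<open>scheme_step\<close> asks.\<close>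

definition laplace_coeff :: "real \<Rightarrow> nat \<Rightarrow> nat \<Rightarrow> real" where
  "laplace_coeff h i j = 1 / h\<^sup>2 * (if i = j then - 2 else if i = j + 1 \<or> j = i + 1 then 1 else 0)"

lemma laplace_coeff_symmetric: "laplace_coeff h i j = laplace_coeff h j i"
  by (auto simp: laplace_coeff_def)

text \<open>Up to the factor 1 / h^2, each row has -2 on the diagonal against at most two neighbours
  of weight 1, hence is weakly diagonally dominant.\<close>

lemma laplace_coeff_nonpos: "(\<Sum>i<m. x i * lin m (laplace_coeff h) x i) \<le> 0"
proof (rule diagonally_dominant_nonpos[OF laplace_coeff_symmetric])
  fix i assume i: "i < m"
  \<comment> \<open>The left neighbour is guarded by 0 < i, since truncated subtraction would
    identify i - 1 with \<open>i\<close> in the first row.\<close>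
  have "(\<Sum>j<m. if i = j then laplace_coeff h i j else \<bar>laplace_coeff h i j\<bar>) =
      1 / h\<^sup>2 * (\<Sum>j<m. (if j = i then - 2 else 0) + (if j = Suc i then 1 else 0)
        + (if j = i - 1 then if 0 < i then 1 else 0 else 0))"
    unfolding sum_distrib_left by (intro sum.cong refl) (auto simp: laplace_coeff_def)
  also have "\<dots> \<le> 0"
    using i by (intro mult_nonneg_nonpos) (auto simp: sum.distrib)
  finally show "(\<Sum>j<m. if i = j then laplace_coeff h i j else \<bar>laplace_coeff h i j\<bar>) \<le> 0" .
qed

lemma laplace_mat_mult_carrier: "laplace_mat h M *\<^sub>v x \<in> carrier_vec (M - 1)"
  by (intro carrier_vecI) (simp add: laplace_mat_def)

lemma laplace_mat_index:
  assumes "x \<in> carrier_vec (M - 1)" "i < M - 1"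
  shows "(laplace_mat h M *\<^sub>v x) $ i = lin (M - 1) (laplace_coeff h) (\<lambda>j. x $ j) i"
  using assms by (auto simp: laplace_mat_def lin_def laplace_coeff_def scalar_prod_def atLeast0LessThan
      intro!: sum.cong)

lemma inner_h_sum: "g \<in> carrier_vec m \<Longrightarrow> inner_h h f g = h * (\<Sum>i<m. f $ i * g $ i)"
  by (simp add: inner_h_def scalar_prod_def atLeast0LessThan)

lemma norm_h_square: "0 \<le> h \<Longrightarrow> f \<in> carrier_vec m \<Longrightarrow> (norm_h h f)\<^sup>2 = h * (\<Sum>i<m. (f $ i)\<^sup>2)"
  by (simp add: norm_h_def inner_h_sum[of f m] power2_eq_square sum_nonneg)

lemma energy_eq_grid_energy:
  assumes h: "0 \<le> h" and carrier: "P \<in> carrier_vec (M - 1)" "Q \<in> carrier_vec (M - 1)"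
    "U \<in> carrier_vec (M - 1)" "V \<in> carrier_vec (M - 1)"
  shows "energy h M P Q U V = h * grid_energy (M - 1) (laplace_coeff h)
    (\<lambda>i. P $ i) (\<lambda>i. Q $ i) (\<lambda>i. U $ i) (\<lambda>i. V $ i)"
proof -
  have "inner_h h x (laplace_mat h M *\<^sub>v x) =
      h * (\<Sum>i<M - 1. x $ i * lin (M - 1) (laplace_coeff h) (\<lambda>j. x $ j) i)"
    if "x \<in> carrier_vec (M - 1)" for x
    unfolding inner_h_sum[OF laplace_mat_mult_carrier] using laplace_mat_index[OF that] by simp
  note A_form = carrier[THEN this]
  have PQ: "P \<odot> P + Q \<odot> Q \<in> carrier_vec (M - 1)"
    using carrier by (simp add: cprod_def)
  have cubic: "inner_h h U (P \<odot> P + Q \<odot> Q) = h * (\<Sum>i<M - 1. U $ i * ((P $ i)\<^sup>2 + (Q $ i)\<^sup>2))"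
    unfolding inner_h_sum[OF PQ] using carrier by (simp add: cprod_def power2_eq_square)
  show ?thesis
    unfolding energy_def grid_energy_def cubic A_form norm_h_square[OF h carrier(3)] norm_h_square[OF h carrier(4)]
    by (simp add: sum.distrib sum_subtractf sum_distrib_left algebra_simps)
qed

text \<open>The Bochner integral of a non-integrable function is 0 by convention; the integrability
  claims give the expectations in the law their meaning.\<close>

theorem theorem3p4:
  fixes \<Omega> :: "'w measure"
    and a b C1 C2 T dt h :: real
    and M N :: nat
    and \<phi>0 :: "real \<Rightarrow> complex"
    and u0 \<mu>0 \<eta>1 \<eta>2 :: "real \<Rightarrow> real"
    and B :: "nat \<Rightarrow> real \<Rightarrow> 'w \<Rightarrow> real"
    and A :: "real mat"
    and e1 e2 :: "real vec"
    and tm :: "nat \<Rightarrow> real"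
    and dB :: "nat \<Rightarrow> nat \<Rightarrow> 'w \<Rightarrow> real"
    and P0 Q0 U0 V0 :: "real vec"
    and P Q U V :: "nat \<Rightarrow> 'w \<Rightarrow> real vec"
  assumes "prob_space \<Omega>"
    and "indep_wiener_processes \<Omega> {0, 1, 2} B"
    and "a < b" and "M \<ge> 1" and "T > 0" and "dt > 0"
    and "\<phi>0 \<in> H10 a b" and "u0 \<in> H10 a b" and "\<mu>0 \<in> L2 a b"
    and "\<eta>1 \<in> H10 a b"
    and "\<eta>2 \<in> L2 a b" and "continuous_on {a..b} \<eta>2"
    and h_def: "h = (b - a) / real M"
    and A_def: "A = laplace_mat h M"
    and e1_def: "e1 = grid_vec a h M \<eta>1"
    and e2_def: "e2 = grid_vec a h M \<eta>2"
    and N_def: "N = nat \<lfloor>T / dt\<rfloor>"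
    and tm_def: "\<And>n. tm n = real n * dt"
    and dB_def: "\<And>k n \<omega>. dB k n \<omega> = B k (tm n) \<omega> - B k (tm (n - 1)) \<omega>"
    and init_carrier: "P0 \<in> carrier_vec (M - 1)" "Q0 \<in> carrier_vec (M - 1)"
          "U0 \<in> carrier_vec (M - 1)" "V0 \<in> carrier_vec (M - 1)"
    and carrier: "\<And>n \<omega>. n \<le> N \<Longrightarrow> \<omega> \<in> space \<Omega> \<Longrightarrow>
          P n \<omega> \<in> carrier_vec (M - 1) \<and> Q n \<omega> \<in> carrier_vec (M - 1) \<and>
          U n \<omega> \<in> carrier_vec (M - 1) \<and> V n \<omega> \<in> carrier_vec (M - 1)"
    and init: "\<And>\<omega>. \<omega> \<in> space \<Omega> \<Longrightarrow>
          P 0 \<omega> = P0 \<and> Q 0 \<omega> = Q0 \<and> U 0 \<omega> = U0 \<and> V 0 \<omega> = V0"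
    and scheme_P: "\<And>n \<omega>. 1 \<le> n \<Longrightarrow> n \<le> N \<Longrightarrow> \<omega> \<in> space \<Omega> \<Longrightarrow>
          P n \<omega> = P (n - 1) \<omega>
            - dt \<cdot>\<^sub>v (A *\<^sub>v ((1/2) \<cdot>\<^sub>v (Q n \<omega> + Q (n - 1) \<omega>))
                     + (1/2) \<cdot>\<^sub>v (U n \<omega> \<odot> (Q n \<omega> + Q (n - 1) \<omega>)))
            + (C1 * dB 1 n \<omega>) \<cdot>\<^sub>v e1
            + (1/2 * dt * C1 * dB 0 n \<omega>) \<cdot>\<^sub>v (A *\<^sub>v e1 + U n \<omega> \<odot> e1)"
    and scheme_Q: "\<And>n \<omega>. 1 \<le> n \<Longrightarrow> n \<le> N \<Longrightarrow> \<omega> \<in> space \<Omega> \<Longrightarrow>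
          Q n \<omega> = Q (n - 1) \<omega>
            + dt \<cdot>\<^sub>v (A *\<^sub>v ((1/2) \<cdot>\<^sub>v (P n \<omega> + P (n - 1) \<omega>))
                     + (1/2) \<cdot>\<^sub>v (U n \<omega> \<odot> (P n \<omega> + P (n - 1) \<omega>)))
            - (C1 * dB 0 n \<omega>) \<cdot>\<^sub>v e1
            + (1/2 * dt * C1 * dB 1 n \<omega>) \<cdot>\<^sub>v (A *\<^sub>v e1 + U n \<omega> \<odot> e1)"
    and scheme_V: "\<And>n \<omega>. 1 \<le> n \<Longrightarrow> n \<le> N \<Longrightarrow> \<omega> \<in> space \<Omega> \<Longrightarrow>
          V n \<omega> = V (n - 1) \<omega>
            + (1/2 * dt) \<cdot>\<^sub>v (A *\<^sub>v ((1/2) \<cdot>\<^sub>v (U n \<omega> + U (n - 1) \<omega>))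
                     - (1/2) \<cdot>\<^sub>v (U n \<omega> + U (n - 1) \<omega>)
                     + P (n - 1) \<omega> \<odot> P (n - 1) \<omega> + Q (n - 1) \<omega> \<odot> Q (n - 1) \<omega>)
            + (1/2 * C2 * dB 2 n \<omega>) \<cdot>\<^sub>v e2
            + dt \<cdot>\<^sub>v ((C1 * dB 1 n \<omega>) \<cdot>\<^sub>v (P (n - 1) \<omega> \<odot> e1)
                     - (C1 * dB 0 n \<omega>) \<cdot>\<^sub>v (Q (n - 1) \<omega> \<odot> e1)
                     + (dt * C1\<^sup>2) \<cdot>\<^sub>v (e1 \<odot> e1))"
    and scheme_U: "\<And>n \<omega>. 1 \<le> n \<Longrightarrow> n \<le> N \<Longrightarrow> \<omega> \<in> space \<Omega> \<Longrightarrow>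
          U n \<omega> = U (n - 1) \<omega> + dt \<cdot>\<^sub>v (V n \<omega> + V (n - 1) \<omega>)
            + (1/2 * dt * C2 * dB 2 n \<omega>) \<cdot>\<^sub>v e2"
  shows "\<forall>n\<le>N.
      integrable \<Omega> (\<lambda>\<omega>. energy h M (P n \<omega>) (Q n \<omega>) (U n \<omega>) (V n \<omega>)) \<and>
      integrable \<Omega> (\<lambda>\<omega>. inner_h h (U n \<omega>) (e1 \<odot> e1)) \<and>
      prob_space.expectation \<Omega> (\<lambda>\<omega>. energy h M (P n \<omega>) (Q n \<omega>) (U n \<omega>) (V n \<omega>)) =
        prob_space.expectation \<Omega> (\<lambda>\<omega>. energy h M (P 0 \<omega>) (Q 0 \<omega>) (U 0 \<omega>) (V 0 \<omega>))
        - C2\<^sup>2 * (norm_h h e2)\<^sup>2 * tm n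
        + 4 * C1\<^sup>2 * inner_h h e1 (A *\<^sub>v e1) * tm n
        + 4 * C1\<^sup>2 * (\<Sum>i<n. prob_space.expectation \<Omega> (\<lambda>\<omega>. inner_h h (U i \<omega>) (e1 \<odot> e1)) * dt)"
proof -
  interpret prob_space \<Omega> by fact
  define m where "m = M - 1"
  define a' where "a' = laplace_coeff h"
  \<comment> \<open>The pair (k, n) stands for the increment from \<open>tm n\<close> to
    \<open>tm (Suc n)\<close>, so the step from \<open>n\<close> to \<open>Suc n\<close> carries the
    index \<open>n\<close>.\<close>
  define X where "X = (\<lambda>(k, n). dB k (Suc n))"
  define K where "K = {0, 1, 2 :: nat}"
  \<comment> \<open>Only time indices below \<open>n\<close> enter. Hence \<open>F 0\<close> is
    trivial, in accordance with the deterministic initial vectors.\<close>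
  define F where "F n = generated \<Omega> X (K \<times> {..<n})" for n
  define \<alpha> where "\<alpha> n \<omega> = C1 * X (1, n) \<omega>" for n \<omega>
  define \<beta> where "\<beta> n \<omega> = C1 * X (0, n) \<omega>" for n \<omega>
  define \<gamma> where "\<gamma> n \<omega> = C2 * X (2, n) \<omega>" for n \<omega>
  define \<xi> where "\<xi> n \<omega> = (\<alpha> n \<omega>)\<^sup>2 + (\<beta> n \<omega>)\<^sup>2 - 2 * C1\<^sup>2 * dt" for n \<omega>
  have h: "0 \<le> h" using \<open>a < b\<close> by (simp add: h_def)
  have dt: "0 < dt" by fact
  have wiener: "wiener_process \<Omega> (B k)" if "k \<in> K" for k
    using that assms(2) by (auto simp: indep_wiener_processes_def K_def)
  have tm_less: "tm n < tm (Suc n)" and tm_nonneg: "0 \<le> tm n" for n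
    using dt by (simp_all add: tm_def)

  \<comment> \<open>Law and independence of the increments\<close>
  have normal: "distributed \<Omega> lborel (X i) (normal_density 0 (sqrt dt))" if "i \<in> K \<times> {..<N}" for i
  proof -
    obtain k n where i: "i = (k, n)" and k: "k \<in> K" using \<open>i \<in> K \<times> {..<N}\<close> by auto
    have "distributed \<Omega> lborel (\<lambda>\<omega>. B k (tm (Suc n)) \<omega> - B k (tm n) \<omega>)
        (normal_density 0 (sqrt (tm (Suc n) - tm n)))"
      using wiener[OF k] tm_less[of n] tm_nonneg[of n] unfolding wiener_process_def by blast
    moreover have "X i = (\<lambda>\<omega>. B k (tm (Suc n)) \<omega> - B k (tm n) \<omega>)"
      by (simp add: X_def i dB_def fun_eq_iff)
    moreover have "tm (Suc n) - tm n = dt" by (simp add: tm_def algebra_simps)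
    ultimately show ?thesis by simp
  qed
  have X_indep: "indep_vars (\<lambda>_. borel) X (K \<times> {..<N})"
  proof -
    \<comment> \<open>Each process is read as one random path on \<open>{0..}\<close>, and
      \<open>f n\<close> recovers an increment from the path. The times \<open>tm n\<close> are
      nonnegative, so the restriction loses no value that is read.\<close>
    define W where "W k \<omega> = (\<lambda>t\<in>{0..}. B k t \<omega>)" for k \<omega>
    define f where "f n w = w (tm (Suc n)) - w (tm n)" for n and w :: "real \<Rightarrow> real"
    have fW: "f n (W k \<omega>) = dB k (Suc n) \<omega>" for n k \<omega>
      using tm_nonneg by (simp add: f_def W_def dB_def)
    have "indep_vars (\<lambda>_. borel) (\<lambda>(k, n) \<omega>. f n (W k \<omega>)) (K \<times> {..<N})"
    proof (rule indep_vars_processes[where W=W and f=f and S="Pi\<^sub>M {0..} (\<lambda>_. borel)"])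
      show "indep_vars (\<lambda>_. Pi\<^sub>M {0..} (\<lambda>_. borel)) W K"
        using assms(2) by (simp add: indep_wiener_processes_def W_def[abs_def] K_def)
      show "f n \<in> borel_measurable (Pi\<^sub>M {0..} (\<lambda>_. borel))" for n
        unfolding f_def[abs_def]
        by (intro borel_measurable_diff measurable_component_singleton) (simp_all add: tm_nonneg)
      show "indep_vars (\<lambda>_. borel) (\<lambda>n \<omega>. f n (W k \<omega>)) {..<N}" if k: "k \<in> K" for k
        using wiener[OF k] tm_nonneg tm_less unfolding wiener_process_def fW dB_def by simp
    qed (simp_all add: K_def)
    moreover have "X = (\<lambda>(k, n) \<omega>. f n (W k \<omega>))"
      by (simp add: X_def fW fun_eq_iff)
    ultimately show ?thesis by simp
  qed
  have X_meas: "X i \<in> borel_measurable \<Omega>" if "i \<in> K \<times> {..<N}" for i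
    by (rule centered_normal_moments(1)[OF normal[OF that] dt])
  have X_moments: "X i \<in> moment_space (generated \<Omega> X I)" if "i \<in> I" "I \<subseteq> K \<times> {..<N}" for i I
    using that by (intro moment_spaceI measurable_generated centered_normal_moments(2)[OF normal dt]) auto
  have sub: "subalgebra \<Omega> (generated \<Omega> X I)" if "I \<subseteq> K \<times> {..<N}" for I
    using that by (intro subalgebra_generated X_meas) auto
  have F_sub: "subalgebra \<Omega> (F n)" if "n \<le> N" for n
    unfolding F_def using that by (intro sub) auto
  have F_mono: "subalgebra (F (Suc n)) (F n)" for n
    unfolding F_def subalgebra_def by (intro conjI sets_generated_mono) auto

  \<comment> \<open>Componentwise form of the scheme\<close>
  have e1: "e1 \<in> carrier_vec m" and e2: "e2 \<in> carrier_vec m"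
    by (simp_all add: e1_def e2_def grid_vec_def m_def)
  have A_index: "(A *\<^sub>v x) $ i = lin m a' (\<lambda>j. x $ j) i" if "x \<in> carrier_vec m" "i < m" for x i
    using laplace_mat_index[of x M i h] that by (simp add: A_def m_def a'_def)
  have A_carrier: "A *\<^sub>v x \<in> carrier_vec m" for x
    unfolding A_def m_def by (rule laplace_mat_mult_carrier)
  have A_average: "(A *\<^sub>v ((1/2) \<cdot>\<^sub>v (x + y))) $ i = lin m a' (\<lambda>j. (x $ j + y $ j) / 2) i"
    if "x \<in> carrier_vec m" "y \<in> carrier_vec m" "i < m" for x y i
    using that by (subst A_index) (auto intro!: lin_cong)
  have carriers: "P n \<omega> \<in> carrier_vec m" "Q n \<omega> \<in> carrier_vec m" "U n \<omega> \<in> carrier_vec m"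
    "V n \<omega> \<in> carrier_vec m" if "n \<le> N" "\<omega> \<in> space \<Omega>" for n \<omega>
    using carrier[OF that] by (simp_all add: m_def)
  have step: "scheme_step m a' dt C1 (\<alpha> n \<omega>) (\<beta> n \<omega>) (\<gamma> n \<omega>) (\<lambda>i. e1 $ i) (\<lambda>i. e2 $ i)
      (\<lambda>i. P n \<omega> $ i) (\<lambda>i. Q n \<omega> $ i) (\<lambda>i. U n \<omega> $ i) (\<lambda>i. V n \<omega> $ i)
      (\<lambda>i. P (Suc n) \<omega> $ i) (\<lambda>i. Q (Suc n) \<omega> $ i) (\<lambda>i. U (Suc n) \<omega> $ i) (\<lambda>i. V (Suc n) \<omega> $ i)"
    if n: "n < N" and \<omega>: "\<omega> \<in> space \<Omega>" for n \<omega>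
  proof -
    note carr = carriers[of n \<omega>] carriers[of "Suc n" \<omega>]
    have dims: "dim_vec (P n \<omega>) = m" "dim_vec (Q n \<omega>) = m" "dim_vec (U n \<omega>) = m" "dim_vec (V n \<omega>) = m"
      "dim_vec (P (Suc n) \<omega>) = m" "dim_vec (Q (Suc n) \<omega>) = m" "dim_vec (U (Suc n) \<omega>) = m"
      "dim_vec (V (Suc n) \<omega>) = m" "dim_vec e1 = m" "dim_vec e2 = m" "dim_row A = m"
      using carr n \<omega> e1 e2 carrier_vecD[OF A_carrier[of e1]] by auto
    have noise: "\<alpha> n \<omega> = C1 * dB 1 (Suc n) \<omega>" "\<beta> n \<omega> = C1 * dB 0 (Suc n) \<omega>" "\<gamma> n \<omega> = C2 * dB 2 (Suc n) \<omega>"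
      by (simp_all add: \<alpha>_def \<beta>_def \<gamma>_def X_def)
    have N: "Suc n \<le> N" "1 \<le> Suc n" using n by auto
    note index = index_add_vec index_minus_vec index_smult_vec cprod_def index_vec dims A_index[OF e1]
      power2_eq_square
    show ?thesis
    proof
      fix i assume i: "i < m"
      have PP: "(A *\<^sub>v ((1/2) \<cdot>\<^sub>v (P (Suc n) \<omega> + P n \<omega>))) $ i = lin m a' (\<lambda>j. (P (Suc n) \<omega> $ j + P n \<omega> $ j) / 2) i"
        and QQ: "(A *\<^sub>v ((1/2) \<cdot>\<^sub>v (Q (Suc n) \<omega> + Q n \<omega>))) $ i = lin m a' (\<lambda>j. (Q (Suc n) \<omega> $ j + Q n \<omega> $ j) / 2) i"
        and UU: "(A *\<^sub>v ((1/2) \<cdot>\<^sub>v (U (Suc n) \<omega> + U n \<omega>))) $ i = lin m a' (\<lambda>j. (U (Suc n) \<omega> $ j + U n \<omega> $ j) / 2) i"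
        using carr n \<omega> i by (auto intro!: A_average)
      show "P (Suc n) \<omega> $ i = P n \<omega> $ i
        - dt * (lin m a' (\<lambda>j. (Q (Suc n) \<omega> $ j + Q n \<omega> $ j) / 2) i + U (Suc n) \<omega> $ i * (Q (Suc n) \<omega> $ i + Q n \<omega> $ i) / 2)
        + \<alpha> n \<omega> * e1 $ i + dt / 2 * \<beta> n \<omega> * (lin m a' (\<lambda>i. e1 $ i) i + U (Suc n) \<omega> $ i * e1 $ i)"
        using arg_cong[OF scheme_P[OF N(2,1) \<omega>], of "\<lambda>x. x $ i"] i unfolding noise
        by (simp add: index QQ del: index_mult_mat_vec)
      show "Q (Suc n) \<omega> $ i = Q n \<omega> $ i
        + dt * (lin m a' (\<lambda>j. (P (Suc n) \<omega> $ j + P n \<omega> $ j) / 2) i + U (Suc n) \<omega> $ i * (P (Suc n) \<omega> $ i + P n \<omega> $ i) / 2)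
        - \<beta> n \<omega> * e1 $ i + dt / 2 * \<alpha> n \<omega> * (lin m a' (\<lambda>i. e1 $ i) i + U (Suc n) \<omega> $ i * e1 $ i)"
        using arg_cong[OF scheme_Q[OF N(2,1) \<omega>], of "\<lambda>x. x $ i"] i unfolding noise
        by (simp add: index PP del: index_mult_mat_vec)
      show "V (Suc n) \<omega> $ i = V n \<omega> $ i
        + dt / 2 * (lin m a' (\<lambda>j. (U (Suc n) \<omega> $ j + U n \<omega> $ j) / 2) i - (U (Suc n) \<omega> $ i + U n \<omega> $ i) / 2
          + (P n \<omega> $ i)\<^sup>2 + (Q n \<omega> $ i)\<^sup>2)
        + \<gamma> n \<omega> / 2 * e2 $ i
        + dt * (\<alpha> n \<omega> * (P n \<omega> $ i * e1 $ i) - \<beta> n \<omega> * (Q n \<omega> $ i * e1 $ i) + dt * C1\<^sup>2 * (e1 $ i)\<^sup>2)"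
        using arg_cong[OF scheme_V[OF N(2,1) \<omega>], of "\<lambda>x. x $ i"] i unfolding noise
        by (simp add: index UU del: index_mult_mat_vec)
      show "U (Suc n) \<omega> $ i = U n \<omega> $ i + dt * (V (Suc n) \<omega> $ i + V n \<omega> $ i) + dt / 2 * \<gamma> n \<omega> * e2 $ i"
        using arg_cong[OF scheme_U[OF N(2,1) \<omega>], of "\<lambda>x. x $ i"] i unfolding noise
        by (simp add: index)
    qed (simp_all add: a'_def laplace_coeff_symmetric[of h] laplace_coeff_nonpos)
  qed

  \<comment> \<open>Adaptedness and moments of the states\<close>
  have state: "(\<lambda>\<omega>. P n \<omega> $ i) \<in> moment_space (F n) \<and> (\<lambda>\<omega>. Q n \<omega> $ i) \<in> moment_space (F n) \<and>
      (\<lambda>\<omega>. U n \<omega> $ i) \<in> moment_space (F n) \<and> (\<lambda>\<omega>. V n \<omega> $ i) \<in> moment_space (F n)"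
    if "n \<le> N" "i < m" for n i
    using that
  proof (induction n arbitrary: i)
    case 0
    \<comment> \<open>The initial state is known to equal the given vectors on the sample space
      only, so membership of the constants is transferred by congruence there.\<close>
    have "(\<lambda>\<omega>. P 0 \<omega> $ i) \<in> moment_space (F 0)" "(\<lambda>\<omega>. Q 0 \<omega> $ i) \<in> moment_space (F 0)"
      "(\<lambda>\<omega>. U 0 \<omega> $ i) \<in> moment_space (F 0)" "(\<lambda>\<omega>. V 0 \<omega> $ i) \<in> moment_space (F 0)"
      by (rule moment_space_cong[OF _ F_sub moment_space_const[of "P0 $ i"]]
          moment_space_cong[OF _ F_sub moment_space_const[of "Q0 $ i"]]
          moment_space_cong[OF _ F_sub moment_space_const[of "U0 $ i"]]
          moment_space_cong[OF _ F_sub moment_space_const[of "V0 $ i"]]; simp add: init)+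
    then show ?case by simp
  next
    case (Suc n)
    have n: "n < N" "n \<le> N" using Suc.prems by auto
    have noise: "\<alpha> n \<in> moment_space (F (Suc n))" "\<beta> n \<in> moment_space (F (Suc n))" "\<gamma> n \<in> moment_space (F (Suc n))"
      unfolding \<alpha>_def[abs_def] \<beta>_def[abs_def] \<gamma>_def[abs_def]
      by (intro moment_space_mult[OF F_sub[OF Suc.prems(1)] moment_space_const];
          use n in \<open>auto simp: F_def K_def intro!: X_moments\<close>)+
    have old: "(\<lambda>\<omega>. P n \<omega> $ i) \<in> moment_space (F (Suc n))" "(\<lambda>\<omega>. Q n \<omega> $ i) \<in> moment_space (F (Suc n))"
      "(\<lambda>\<omega>. U n \<omega> $ i) \<in> moment_space (F (Suc n))" "(\<lambda>\<omega>. V n \<omega> $ i) \<in> moment_space (F (Suc n))"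
      if "i < m" for i
      using Suc.IH[OF n(2) that] by (auto intro: moment_space_mono[OF F_mono])
    show ?case
      using moment_space_scheme_step[OF F_sub[OF Suc.prems(1)] step[OF n(1)] noise old Suc.prems(2)]
      by blast
  qed

  \<comment> \<open>Evolution of the mean energy\<close>
  define E where "E n = expectation (\<lambda>\<omega>. grid_energy m a' (\<lambda>i. P n \<omega> $ i) (\<lambda>i. Q n \<omega> $ i)
      (\<lambda>i. U n \<omega> $ i) (\<lambda>i. V n \<omega> $ i))" for n
  define S where "S n \<omega> = (\<Sum>i<m. U n \<omega> $ i * (e1 $ i)\<^sup>2)" for n \<omega>
  have E_step: "E (Suc n) = E n + 4 * C1\<^sup>2 * dt * (\<Sum>i<m. e1 $ i * lin m a' (\<lambda>i. e1 $ i) i)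
      + 4 * C1\<^sup>2 * dt * expectation (S n) - C2\<^sup>2 * dt * (\<Sum>i<m. (e2 $ i)\<^sup>2)" if n: "n < N" for n
  proof -
    have I: "K \<times> {n} \<subseteq> K \<times> {..<N}" "K \<times> {..<n} \<subseteq> K \<times> {..<N}" using n by auto
    have mem: "(1, n) \<in> K \<times> {..<N}" "(0, n) \<in> K \<times> {..<N}" "(2, n) \<in> K \<times> {..<N}"
      "(1, n) \<noteq> (0 :: nat, n)" "(1, n) \<noteq> (2 :: nat, n)" "(0, n) \<noteq> (2 :: nat, n)"
      using n by (auto simp: K_def)
    note noise = noise_moments[OF X_indep mem normal dt \<alpha>_def[of n] \<beta>_def[of n] \<gamma>_def[of n] \<xi>_def[of n]]
    \<comment> \<open>The time indices below \<open>n\<close> and the index \<open>n\<close> form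
      disjoint blocks, so the noise of the step is independent of the state reached before
      it.\<close>
    have ind: "indep_set (sets (F n)) (sets (generated \<Omega> X (K \<times> {n})))"
      unfolding F_def using I by (intro indep_set_generated[OF X_indep]) auto
    have noise_space: "\<alpha> n \<in> moment_space (generated \<Omega> X (K \<times> {n}))"
      "\<beta> n \<in> moment_space (generated \<Omega> X (K \<times> {n}))" "\<gamma> n \<in> moment_space (generated \<Omega> X (K \<times> {n}))"
      unfolding \<alpha>_def[abs_def] \<beta>_def[abs_def] \<gamma>_def[abs_def]
      by (intro moment_space_mult[OF sub[OF I(1)] moment_space_const];
          use I(1) in \<open>auto simp: K_def intro!: X_moments\<close>)+
    have old: "(\<lambda>\<omega>. P n \<omega> $ i) \<in> moment_space (F n)" "(\<lambda>\<omega>. Q n \<omega> $ i) \<in> moment_space (F n)"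
      "(\<lambda>\<omega>. U n \<omega> $ i) \<in> moment_space (F n)" "(\<lambda>\<omega>. V n \<omega> $ i) \<in> moment_space (F n)" if "i < m" for i
      using state[of n i] n that by auto
    show ?thesis
      unfolding E_def S_def[abs_def]
      by (rule expectation_energy_step[OF F_sub sub[OF I(1)] ind step[OF n] old noise_space \<xi>_def[of n]])
        (use n noise in auto)
  qed
  have E_n: "E n = E 0 - C2\<^sup>2 * (\<Sum>i<m. (e2 $ i)\<^sup>2) * tm n
      + 4 * C1\<^sup>2 * (\<Sum>i<m. e1 $ i * lin m a' (\<lambda>i. e1 $ i) i) * tm n
      + 4 * C1\<^sup>2 * (\<Sum>k<n. expectation (S k) * dt)" if "n \<le> N" for n
    using that
  proof (induction n)
    case 0
    show ?case by (simp add: tm_def)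
  next
    case (Suc n)
    then have n: "n < N" "n \<le> N" by auto
    show ?case
      unfolding E_step[OF n(1)] Suc.IH[OF n(2)] by (simp add: tm_def algebra_simps)
  qed

  \<comment> \<open>Return to the weighted inner product\<close>
  have energy: "energy h M (P n \<omega>) (Q n \<omega>) (U n \<omega>) (V n \<omega>) =
      h * grid_energy m a' (\<lambda>i. P n \<omega> $ i) (\<lambda>i. Q n \<omega> $ i) (\<lambda>i. U n \<omega> $ i) (\<lambda>i. V n \<omega> $ i)"
    if "n \<le> N" "\<omega> \<in> space \<Omega>" for n \<omega>
    using energy_eq_grid_energy[OF h, of "P n \<omega>" M "Q n \<omega>" "U n \<omega>" "V n \<omega>"] carriers[OF that]
    by (simp add: m_def a'_def)
  have ee: "e1 \<odot> e1 \<in> carrier_vec m" using e1 by (simp add: cprod_def)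
  \<comment> \<open>\<open>scalar_prod\<close> takes its range from the second argument, whose
    dimension is fixed, so the identity holds at every \<omega>.\<close>
  have inner: "inner_h h (U n \<omega>) (e1 \<odot> e1) = h * S n \<omega>" for n \<omega>
    unfolding inner_h_sum[OF ee] S_def using e1 by (simp add: cprod_def power2_eq_square)
  have S_int: "integrable \<Omega> (S n)" if n: "n \<le> N" for n
    unfolding S_def[abs_def] using state[OF n]
    by (intro moment_space_integrable[OF F_sub[OF n]] moment_space_intros[OF F_sub[OF n]] moment_space_const) auto
  have E_int: "integrable \<Omega> (\<lambda>\<omega>. grid_energy m a' (\<lambda>i. P n \<omega> $ i) (\<lambda>i. Q n \<omega> $ i)
      (\<lambda>i. U n \<omega> $ i) (\<lambda>i. V n \<omega> $ i))" if n: "n \<le> N" for n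
    unfolding grid_energy_def using state[OF n]
    by (intro moment_space_integrable[OF F_sub[OF n]] moment_space_intros[OF F_sub[OF n]] moment_space_const) auto
  have energy_E: "expectation (\<lambda>\<omega>. energy h M (P n \<omega>) (Q n \<omega>) (U n \<omega>) (V n \<omega>)) = h * E n"
    if n: "n \<le> N" for n
    unfolding E_def using energy[OF n]
    by (simp cong: Bochner_Integration.integral_cong)
  have energy_int: "integrable \<Omega> (\<lambda>\<omega>. energy h M (P n \<omega>) (Q n \<omega>) (U n \<omega>) (V n \<omega>))"
    if n: "n \<le> N" for n
    using E_int[OF n] energy[OF n]
    by (simp cong: Bochner_Integration.integrable_cong)
  have e2_norm: "(norm_h h e2)\<^sup>2 = h * (\<Sum>i<m. (e2 $ i)\<^sup>2)"
    by (rule norm_h_square[OF h e2])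
  have e1_form: "inner_h h e1 (A *\<^sub>v e1) = h * (\<Sum>i<m. e1 $ i * lin m a' (\<lambda>i. e1 $ i) i)"
    unfolding inner_h_sum[OF A_carrier] using A_index[OF e1] by simp
  show ?thesis
  proof (intro allI impI conjI)
    fix n assume n: "n \<le> N"
    show "integrable \<Omega> (\<lambda>\<omega>. energy h M (P n \<omega>) (Q n \<omega>) (U n \<omega>) (V n \<omega>))"
      by (rule energy_int[OF n])
    show "integrable \<Omega> (\<lambda>\<omega>. inner_h h (U n \<omega>) (e1 \<odot> e1))"
      unfolding inner using S_int[OF n] by simp
    show "expectation (\<lambda>\<omega>. energy h M (P n \<omega>) (Q n \<omega>) (U n \<omega>) (V n \<omega>)) =
        expectation (\<lambda>\<omega>. energy h M (P 0 \<omega>) (Q 0 \<omega>) (U 0 \<omega>) (V 0 \<omega>))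
        - C2\<^sup>2 * (norm_h h e2)\<^sup>2 * tm n
        + 4 * C1\<^sup>2 * inner_h h e1 (A *\<^sub>v e1) * tm n
        + 4 * C1\<^sup>2 * (\<Sum>i<n. expectation (\<lambda>\<omega>. inner_h h (U i \<omega>) (e1 \<odot> e1)) * dt)"
      unfolding energy_E[OF n] energy_E[of 0, simplified] inner e2_norm e1_form E_n[OF n]
      by (simp add: sum_distrib_left algebra_simps)
  qed
qed

end
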